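(* Let $h>0$ and $b_0>0$. Suppose that $(u_0,b_0)$ satisfies $$0\le u_0\in W^{1,\infty}(0,+\infty),\qquad u_0(0)>0,\qquad u_0(x)=0 \ \text{ for all } x\in[b_0,\infty).$$ Let $(u,s)$ be the corresponding (unique) classical solution of the one-phase Stefan problem $$\begin{array}{ll} u_t(x,t)-u_{xx}(x,t)=0, & t>0,\ 0<x<s(t),\\ -u_x(0,t)=\dfrac{h}{\sqrt{t+1}},\quad u(s(t),t)=0, & t>0,\\ \dot s(t)=-u_x(s(t),t), & t>0,\\ u(x,0)=u_0(x), & 0<x<s(0)=b_0,\end{array}$$ and extend $u(\cdot,t)$ by $0$ to $x>s(t)$. Let $\omega$ be the unique positive solution of $h=\frac{\omega}{2}e^{\omega^2/4}$ and let $U(\eta)=h\int_\eta^\omega e^{-r^2/4}\,dr$ for $\eta\in[0,\omega]$. Then: 1) $\displaystyle\lim_{t\to\infty}\frac{s(t)}{\sqrt{t+1}}=\omega$; 2) $\displaystyle\lim_{t\to\infty}\ \sup_{x/\sqrt{t+1}\in[0,\omega]}\left|u(x,t)-U\!\left(\frac{x}{\sqrt{t+1}}\right)\right|=0.$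
   Context: A classical solution $(u,s)$ of the Stefan problem is a pair satisfying the equations with $s\in C^1([0,\infty))$, $u\in C^{2,1}(\{(x,t): t>0,\ 0<x<s(t)\})$ (twice continuously differentiable in $x$, once in $t$), $u\in C(\{(x,t): t\ge 0,\ 0\le x\le s(t)\})$ and $u_x\in C(\{(x,t): t>0,\ 0\le x\le s(t)\})$. The paper recalls from the literature that for initial data as in the claim and $h>0$ a classical solution exists for all $t>0$ and is unique. *)

theory Defs
  imports "HOL-Analysis.Analysis"
begin

definition test_fun :: "real set \<Rightarrow> (real \<Rightarrow> real) \<Rightarrow> bool" where
  "test_fun S \<phi> \<longleftrightarrow>
     (\<forall>n x. (deriv ^^ n) \<phi> differentiable (at x)) \<and>
     compact (closure {x. \<phi> x \<noteq> 0}) \<and> closure {x. \<phi> x \<noteq> 0} \<subseteq> S"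

definition Linf_on :: "real set \<Rightarrow> (real \<Rightarrow> real) \<Rightarrow> bool" where
  "Linf_on S f \<longleftrightarrow>
     f \<in> borel_measurable (lebesgue_on S) \<and> (\<exists>C. AE x in lebesgue_on S. \<bar>f x\<bar> \<le> C)"

definition weak_deriv_on :: "real set \<Rightarrow> (real \<Rightarrow> real) \<Rightarrow> (real \<Rightarrow> real) \<Rightarrow> bool" where
  "weak_deriv_on S f g \<longleftrightarrow>
     (\<forall>\<phi>. test_fun S \<phi> \<longrightarrow>
        (LINT x|lebesgue_on S. f x * deriv \<phi> x) = - (LINT x|lebesgue_on S. g x * \<phi> x))"

text \<open>Membership is invariant under changes on null sets; pointwise conditions on such an \<open>f\<close>
  are meaningful only for its continuous representative, so continuity has to be required
  separately where they are used.\<close>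

definition W1inf_on :: "real set \<Rightarrow> (real \<Rightarrow> real) \<Rightarrow> bool" where
  "W1inf_on S f \<longleftrightarrow> Linf_on S f \<and> (\<exists>g. Linf_on S g \<and> weak_deriv_on S f g)"

text \<open>The regions below are sets of pairs \<open>(x, t)\<close>, space variable first.\<close>

definition stefan_interior :: "(real \<Rightarrow> real) \<Rightarrow> (real \<times> real) set" where
  "stefan_interior s = {(x, t). 0 < t \<and> 0 < x \<and> x < s t}"

definition stefan_closed :: "(real \<Rightarrow> real) \<Rightarrow> (real \<times> real) set" where
  "stefan_closed s = {(x, t). 0 \<le> t \<and> 0 \<le> x \<and> x \<le> s t}"

definition stefan_closed_pos :: "(real \<Rightarrow> real) \<Rightarrow> (real \<times> real) set" where
  "stefan_closed_pos s = {(x, t). 0 < t \<and> 0 \<le> x \<and> x \<le> s t}"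

definition C1_with_deriv :: "(real \<Rightarrow> real) \<Rightarrow> (real \<Rightarrow> real) \<Rightarrow> bool" where
  "C1_with_deriv s s' \<longleftrightarrow>
     (\<forall>t\<ge>0. (s has_real_derivative s' t) (at t within {0..})) \<and> continuous_on {0..} s'"

definition C21_with_derivs ::
  "(real \<times> real) set \<Rightarrow> (real \<Rightarrow> real \<Rightarrow> real) \<Rightarrow> (real \<Rightarrow> real \<Rightarrow> real) \<Rightarrow>
   (real \<Rightarrow> real \<Rightarrow> real) \<Rightarrow> (real \<Rightarrow> real \<Rightarrow> real) \<Rightarrow> bool" where
  "C21_with_derivs D u ux uxx ut \<longleftrightarrow>
     (\<forall>(x, t)\<in>D.
        ((\<lambda>y. u y t) has_real_derivative ux x t) (at x) \<and>
        ((\<lambda>y. ux y t) has_real_derivative uxx x t) (at x) \<and>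
        ((\<lambda>r. u x r) has_real_derivative ut x t) (at t)) \<and>
     continuous_on D (\<lambda>(x, t). u x t) \<and> continuous_on D (\<lambda>(x, t). ux x t) \<and>
     continuous_on D (\<lambda>(x, t). uxx x t) \<and> continuous_on D (\<lambda>(x, t). ut x t)"

text \<open>At \<open>x = 0\<close> and \<open>x = s t\<close> the function \<open>ux\<close> is the one-sided space derivative of \<open>u\<close>.
  The values of \<open>u\<close> outside \<^term>\<open>stefan_closed s\<close> are irrelevant. Positivity of \<open>s\<close> is not
  required: it follows from \<open>s 0 = b0 > 0\<close> and the equations by the maximum principle.\<close>

definition classical_stefan_solution ::
  "real \<Rightarrow> real \<Rightarrow> (real \<Rightarrow> real) \<Rightarrow> (real \<Rightarrow> real \<Rightarrow> real) \<Rightarrow> (real \<Rightarrow> real) \<Rightarrow> bool" where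
  "classical_stefan_solution h b0 u0 u s \<longleftrightarrow>
     (\<exists>s' ux uxx ut.
        C1_with_deriv s s' \<and>
        C21_with_derivs (stefan_interior s) u ux uxx ut \<and>
        continuous_on (stefan_closed s) (\<lambda>(x, t). u x t) \<and>
        (\<forall>(x, t)\<in>stefan_closed_pos s.
           ((\<lambda>y. u y t) has_real_derivative ux x t) (at x within {0..s t})) \<and>
        continuous_on (stefan_closed_pos s) (\<lambda>(x, t). ux x t) \<and>
        (\<forall>(x, t)\<in>stefan_interior s. ut x t - uxx x t = 0) \<and>
        (\<forall>t>0. - ux 0 t = h / sqrt (t + 1)) \<and>
        (\<forall>t>0. u (s t) t = 0) \<and>
        (\<forall>t>0. s' t = - ux (s t) t) \<and>
        s 0 = b0 \<and>
        (\<forall>x. 0 < x \<and> x < b0 \<longrightarrow> u x 0 = u0 x))"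

definition zero_extension ::
  "(real \<Rightarrow> real) \<Rightarrow> (real \<Rightarrow> real \<Rightarrow> real) \<Rightarrow> real \<Rightarrow> real \<Rightarrow> real" where
  "zero_extension s u x t = (if x \<le> s t then u x t else 0)"

definition stefan_omega :: "real \<Rightarrow> real" where
  "stefan_omega h = (THE \<omega>. 0 < \<omega> \<and> h = \<omega> / 2 * exp (\<omega>\<^sup>2 / 4))"

lemma stefan_omega_ex1:
  fixes h :: real
  assumes "0 < h"
  shows "\<exists>!\<omega>. 0 < \<omega> \<and> h = \<omega> / 2 * exp (\<omega>\<^sup>2 / 4)"
proof -
  let ?f = "\<lambda>\<omega>::real. \<omega> / 2 * exp (\<omega>\<^sup>2 / 4)"
  have mono: "?f a < ?f b" if "0 < a" "a < b" for a b
    using that by (intro mult_strict_mono) (auto intro: power_strict_mono)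
  have "1 \<le> exp ((2 * h)\<^sup>2 / 4)" by simp
  then have "h \<le> ?f (2 * h)" using assms mult_left_mono[of 1 _ h] by simp
  moreover have "continuous_on {0..2 * h} ?f" by (intro continuous_intros) auto
  ultimately obtain w where w: "0 \<le> w" "w \<le> 2 * h" "?f w = h"
    using IVT'[of ?f 0 h "2 * h"] assms by auto
  with assms have "0 < w" by (cases "w = 0") auto
  show ?thesis
  proof (rule ex1I[of _ w])
    show "0 < w \<and> h = ?f w" using w \<open>0 < w\<close> by simp
    show "v = w" if "0 < v \<and> h = ?f v" for v
      using that w \<open>0 < w\<close> mono[of v w] mono[of w v] by (cases v w rule: linorder_cases) auto
  qed
qed

definition stefan_profile :: "real \<Rightarrow> real \<Rightarrow> real" where
  "stefan_profile h \<eta> = h * integral {\<eta>..stefan_omega h} (\<lambda>r. exp (- (r\<^sup>2) / 4))"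

end

theory Submission
  imports Defs
begin

text \<open>
  In the similarity variable \<open>\<eta> = x / sqrt (t + 1)\<close> and the time \<open>ln (t + 1)\<close> the Stefan problem
  becomes autonomous: the flux at \<open>\<eta> = 0\<close> is the constant \<open>h\<close>, and a front at \<open>\<eta> = l\<close> satisfies
  \<open>l' + l / 2 = - v\<^sub>\<eta>(l)\<close>. For each \<open>l\<close> the profile \<open>h * (\<integral>r=\<eta>..l. exp (- r\<^sup>2 / 4))\<close>
  solves the equation and the flux condition; its front balance \<open>l / 2 - h * exp (- l\<^sup>2 / 4)\<close> is
  strictly increasing in \<open>l\<close> and vanishes exactly at \<open>l = \<omega>\<close>. So for \<open>l > \<omega>\<close> this profile fails the
  Stefan condition strictly in the direction of a supersolution, for \<open>l < \<omega>\<close> in the direction of a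
  subsolution. There is room left to add a small correction
  \<open>\<kappa> * ((l\<^sup>2 - \<eta>\<^sup>2) / 2 + (l - \<eta>))\<close>, which makes the heat equation and the flux condition
  strict as well, and then to let \<open>l\<close> move slowly towards \<open>\<omega> \<plusminus> \<epsilon>\<close>. This gives explicit barriers whose
  fronts are \<open>l(t) * sqrt (t + 1)\<close> with \<open>l(t) = \<omega> \<plusminus> \<epsilon> + C * (t + 1) powr (- m)\<close>, starting from an
  arbitrarily large or an arbitrarily small \<open>l(0)\<close>; one barrier of each kind therefore traps the
  given initial data.

  All inequalities of the barriers are strict, so comparison comes down to elementary calculus: at
  the first time at which a barrier and the solution touch, the first and second derivative tests
  contradict one of the strict inequalities
  (\<open>parabolic_positivity\<close>, \<open>free_boundary_comparison\<close>). The same argument applied to \<open>u + k * (t + 1)\<close>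
  shows that \<open>u\<close> is nonnegative, hence that the front does not recede and stays positive. The
  solution thus lies between the barriers (\<open>below_upper_barrier\<close>, \<open>above_lower_barrier\<close>), whose
  limits differ from \<open>\<omega>\<close> and \<open>U\<close> by a multiple of \<open>\<epsilon>\<close>, and \<open>\<epsilon>\<close> is arbitrary.
\<close>

section \<open>Comparison by the first zero\<close>

lemma nonneg_at_left_limit:
  fixes d :: "real \<Rightarrow> real \<Rightarrow> real"
  assumes cont: "continuous_on D (\<lambda>(x, t). d x t)" and mem: "(x, T) \<in> D"
    and ev: "eventually (\<lambda>t. (x, t) \<in> D \<and> 0 \<le> d x t) (at_left T)"
  shows "0 \<le> d x T"
proof -
  have "((\<lambda>(x, t). d x t) \<longlongrightarrow> d x T) (at (x, T) within D)"
    using cont mem by (auto simp: continuous_on_def)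
  moreover have "filterlim (\<lambda>t. (x, t)) (at (x, T) within D) (at_left T)"
    unfolding filterlim_at
  proof
    have "eventually (\<lambda>t. t < T) (at_left T)"
      by (simp add: eventually_at_filter)
    with ev show "\<forall>\<^sub>F t in at_left T. (x, t) \<in> D \<and> (x, t) \<noteq> (x, T)"
      by eventually_elim auto
    show "((\<lambda>t. (x, t)) \<longlongrightarrow> (x, T)) (at_left T)"
      by (intro tendsto_intros)
  qed
  ultimately have "((\<lambda>t. d x t) \<longlongrightarrow> d x T) (at_left T)"
    by (auto dest: filterlim_compose)
  then show ?thesis
    by (rule tendsto_lowerbound) (use ev in \<open>auto elim: eventually_mono\<close>)
qed

lemma second_derivative_nonneg_at_min:
  fixes f f' :: "real \<Rightarrow> real"
  assumes x: "a < x" "x < b"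
    and min: "\<And>y. a < y \<Longrightarrow> y < b \<Longrightarrow> f x \<le> f y"
    and f': "\<And>y. a < y \<Longrightarrow> y < b \<Longrightarrow> (f has_real_derivative f' y) (at y)"
    and c: "(f' has_real_derivative c) (at x)"
  shows "f' x = 0" and "0 \<le> c"
proof -
  show zero: "f' x = 0"
  proof (rule DERIV_local_min[OF f'[OF x]])
    show "0 < min (x - a) (b - x)" using x by simp
    show "\<forall>y. \<bar>x - y\<bar> < min (x - a) (b - x) \<longrightarrow> f x \<le> f y"
      using min by (auto simp: abs_if split: if_splits)
  qed
  show "0 \<le> c"
  proof (rule ccontr)
    assume "\<not> 0 \<le> c"
    then obtain e where e: "0 < e" "\<And>k. 0 < k \<Longrightarrow> k < e \<Longrightarrow> f' (x + k) < f' x"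
      using DERIV_neg_dec_right[OF c] by auto
    define k where "k = min e (b - x) / 2"
    have k: "0 < k" "k < e" "x + k < b"
      using e x by (auto simp: k_def min_def field_simps)
    obtain z where z: "x < z" "z < x + k" "f (x + k) - f x = (x + k - x) * f' z"
      using MVT2[of x "x + k" f f'] f' x k by auto
    have "f' z < 0"
      using e(2)[of "z - x"] z k zero by auto
    then have "f (x + k) < f x"
      using z k mult_pos_neg[of k "f' z"] by simp
    with min[of "x + k"] x k show False by auto
  qed
qed

text \<open>
  A positive \<open>d\<close> has a first zero if it ever vanishes. There \<open>d\<close> is minimal in space and has come
  down in time; this contradicts \<open>dxx < dt\<close> inside the region and the sign of \<open>dx\<close> at its two ends.
  The time interval is half open because in the comparison of two fronts the region is only under
  control until the fronts meet.
\<close>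

lemma parabolic_positivity:
  fixes s :: "real \<Rightarrow> real" and d dx dxx dt :: "real \<Rightarrow> real \<Rightarrow> real"
  assumes s_cont: "continuous_on {0..<T} s"
    and s_pos: "\<And>t. 0 \<le> t \<Longrightarrow> t < T \<Longrightarrow> 0 < s t"
    and d_cont: "continuous_on {(x, t). 0 \<le> t \<and> t < T \<and> 0 \<le> x \<and> x \<le> s t} (\<lambda>(x, t). d x t)"
    and init: "\<And>x. 0 \<le> x \<Longrightarrow> x \<le> s 0 \<Longrightarrow> 0 < d x 0"
    and dx: "\<And>x t. 0 < t \<Longrightarrow> t < T \<Longrightarrow> 0 \<le> x \<Longrightarrow> x \<le> s t \<Longrightarrow>
        ((\<lambda>y. d y t) has_real_derivative dx x t) (at x within {0..s t})"
    and dxx: "\<And>x t. 0 < t \<Longrightarrow> t < T \<Longrightarrow> 0 < x \<Longrightarrow> x < s t \<Longrightarrow>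
        ((\<lambda>y. dx y t) has_real_derivative dxx x t) (at x)"
    and dt: "\<And>x t. 0 < t \<Longrightarrow> t < T \<Longrightarrow> 0 < x \<Longrightarrow> x < s t \<Longrightarrow>
        ((\<lambda>r. d x r) has_real_derivative dt x t) (at t)"
    and heat: "\<And>x t. 0 < t \<Longrightarrow> t < T \<Longrightarrow> 0 < x \<Longrightarrow> x < s t \<Longrightarrow> dxx x t < dt x t"
    and left: "\<And>t. 0 < t \<Longrightarrow> t < T \<Longrightarrow> dx 0 t < 0"
    and right: "\<And>t. 0 < t \<Longrightarrow> t < T \<Longrightarrow> 0 < d (s t) t \<or> 0 < dx (s t) t"
    and pt: "0 \<le> t0" "t0 < T" "0 \<le> x0" "x0 \<le> s t0"
  shows "0 < d x0 t0"
proof (rule ccontr)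
  assume neg: "\<not> 0 < d x0 t0"
  let ?D = "{(x, t). 0 \<le> t \<and> t < T \<and> 0 \<le> x \<and> x \<le> s t}"
  define K where "K = {(x, t). 0 \<le> t \<and> t \<le> t0 \<and> 0 \<le> x \<and> x \<le> s t}"
  have K_image: "K = (\<lambda>(y, t). (y * s t, t)) ` ({0..1} \<times> {0..t0})"
  proof (intro equalityI subsetI)
    fix p assume "p \<in> K"
    then obtain x t where p: "p = (x, t)" "0 \<le> t" "t \<le> t0" "0 \<le> x" "x \<le> s t"
      by (auto simp: K_def)
    have "0 < s t" using s_pos p pt by simp
    then have "p = (\<lambda>(y, t). (y * s t, t)) (x / s t, t)" "x / s t \<in> {0..1}"
      using p by (auto simp: field_simps)
    then show "p \<in> (\<lambda>(y, t). (y * s t, t)) ` ({0..1} \<times> {0..t0})"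
      using p by (intro image_eqI[of _ _ "(x / s t, t)"]) auto
  next
    fix p assume "p \<in> (\<lambda>(y, t). (y * s t, t)) ` ({0..1} \<times> {0..t0})"
    then obtain q where q: "q \<in> {0..1} \<times> {0..t0}" "p = (\<lambda>(y, t). (y * s t, t)) q" by blast
    obtain y t where "q = (y, t)" by (cases q)
    with q have p: "p = (y * s t, t)" "0 \<le> y" "y \<le> 1" "0 \<le> t" "t \<le> t0" by auto
    have "0 < s t" using s_pos p pt by simp
    with p show "p \<in> K" by (auto simp: K_def mult_left_le_one_le)
  qed
  have "continuous_on ({0..1} \<times> {0..t0}) (\<lambda>p. s (snd p))"
    by (rule continuous_on_compose2[OF s_cont]) (use pt in \<open>auto intro: continuous_intros\<close>)
  then have "compact K"
    unfolding K_image case_prod_unfold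
    by (intro compact_continuous_image continuous_intros compact_Times) auto
  \<comment> \<open>The first zero is the point of \<open>Z\<close> with the least time; straightening the front makes \<open>K\<close>,
    and with it \<open>Z\<close>, compact.\<close>
  define Z where "Z = K \<inter> (\<lambda>(x, t). d x t) -` {..0}"
  have "continuous_on K (\<lambda>(x, t). d x t)"
    by (rule continuous_on_subset[OF d_cont]) (use pt in \<open>auto simp: K_def\<close>)
  then have "closed Z"
    unfolding Z_def using \<open>compact K\<close>
    by (intro continuous_closed_preimage) (auto simp: compact_imp_closed)
  then have "compact Z"
    using compact_Int_closed[OF \<open>compact K\<close>, of Z] by (simp add: Z_def)
  moreover have "(x0, t0) \<in> Z"
    using neg pt by (auto simp: Z_def K_def)
  ultimately obtain p1 where "p1 \<in> Z" and p1: "\<And>p. p \<in> Z \<Longrightarrow> snd p1 \<le> snd p"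
    using continuous_attains_inf[of Z snd] continuous_on_snd[OF continuous_on_id, of Z] by blast
  obtain x1 t1 where "p1 = (x1, t1)" by (cases p1)
  then have z: "0 \<le> t1" "t1 \<le> t0" "0 \<le> x1" "x1 \<le> s t1" "d x1 t1 \<le> 0"
    using \<open>p1 \<in> Z\<close> by (auto simp: Z_def K_def)
  have before: "0 < d x t" if "0 \<le> t" "t < t1" "0 \<le> x" "x \<le> s t" for x t
  proof (rule ccontr)
    assume "\<not> 0 < d x t"
    then have "(x, t) \<in> Z" using that z by (auto simp: Z_def K_def)
    then show False using p1[of "(x, t)"] that \<open>p1 = (x1, t1)\<close> by auto
  qed
  have t1: "0 < t1" "t1 < T" "0 < s t1"
    using init[of x1] z pt s_pos by (cases "t1 = 0"; force)+
  have "isCont s t1"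
    using s_cont t1 by (intro continuous_on_interior[where S = "{0..<T}"]) (auto simp: interior_atLeastLessThan)
  then have s_tendsto: "(s \<longlongrightarrow> s t1) (at_left t1)"
    by (simp add: isCont_def filterlim_at_split)
  have near: "eventually (\<lambda>t. 0 < t \<and> t < t1 \<and> x < s t) (at_left t1)" if "x < s t1" for x
  proof -
    have "eventually (\<lambda>t. 0 < t \<and> t < t1) (at_left t1)"
      using eventually_at_left_real[OF t1(1)] by (auto elim: eventually_mono)
    with order_tendstoD(1)[OF s_tendsto that] show ?thesis
      by eventually_elim auto
  qed
  \<comment> \<open>A point of the open slice is reached from earlier times inside the region; an endpoint of the
    slice need not be, but the derivative tests there only use interior neighbours.\<close>
  have nonneg: "0 \<le> d x t1" if "0 < x" "x < s t1" for x
  proof (rule nonneg_at_left_limit[OF d_cont])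
    show "(x, t1) \<in> ?D" using that t1 by auto
    show "eventually (\<lambda>t. (x, t) \<in> ?D \<and> 0 \<le> d x t) (at_left t1)"
      using near[OF that(2)] by eventually_elim (use that t1 before in \<open>auto intro: less_imp_le\<close>)
  qed
  consider "x1 = 0" | "x1 = s t1" | "0 < x1" "x1 < s t1" using z by linarith
  then show False
  proof cases
    case 1
    obtain e where e: "0 < e"
        "\<And>k. 0 < k \<Longrightarrow> 0 + k \<in> {0..s t1} \<Longrightarrow> k < e \<Longrightarrow> d (0 + k) t1 < d 0 t1"
      using has_real_derivative_neg_dec_right[OF dx[of t1 0] left] t1 by auto
    define k where "k = min e (s t1) / 2"
    have "0 < k" "k < e" "k < s t1" using e t1 by (auto simp: k_def min_def field_simps)
    then show False using e(2)[of k] nonneg[of k] z 1 by auto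
  next
    case 2
    then have "0 < dx (s t1) t1" using right[of t1] z t1 by auto
    then obtain e where e: "0 < e"
        "\<And>k. 0 < k \<Longrightarrow> s t1 - k \<in> {0..s t1} \<Longrightarrow> k < e \<Longrightarrow> d (s t1 - k) t1 < d (s t1) t1"
      using has_real_derivative_pos_inc_left[OF dx[of t1 "s t1"]] t1 by auto
    define k where "k = min e (s t1) / 2"
    have "0 < k" "k < e" "k < s t1" using e t1 by (auto simp: k_def min_def field_simps)
    then show False using e(2)[of k] nonneg[of "s t1 - k"] z 2 by auto
  next
    case 3
    have zero: "d x1 t1 = 0" using nonneg 3 z by force
    have dx_at: "((\<lambda>y. d y t1) has_real_derivative dx y t1) (at y)" if "0 < y" "y < s t1" for y
      using dx[of t1 y] that t1 at_within_interior[of y "{0..s t1}"] by (simp add: interior_atLeastAtMost_real)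
    have "0 \<le> dxx x1 t1"
      by (rule second_derivative_nonneg_at_min(2)[OF 3 _ dx_at dxx]) (use nonneg zero t1 3 in auto)
    then have "0 < dt x1 t1" using heat[of t1 x1] 3 t1 by auto
    then obtain e where e: "0 < e" "\<And>k. 0 < k \<Longrightarrow> k < e \<Longrightarrow> d x1 (t1 - k) < d x1 t1"
      using DERIV_pos_inc_left[OF dt[of t1 x1]] 3 t1 by auto
    have "eventually (\<lambda>t. t1 - e < t \<and> t < t1) (at_left t1)"
      using eventually_at_left_real[of "t1 - e" t1] e by (auto elim: eventually_mono)
    with near[OF 3(2)] have "eventually (\<lambda>t. False) (at_left t1)"
    proof eventually_elim
      case (elim t)
      then show False using e(2)[of "t1 - t"] before[of t x1] zero 3 by auto
    qed
    then show False by simp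
  qed
qed

lemma first_nonpositive_time:
  fixes g :: "real \<Rightarrow> real"
  assumes cont: "continuous_on {0..} g" and init: "0 < g 0" and r: "0 \<le> r" "g r \<le> 0"
  shows "\<exists>T>0. g T = 0 \<and> (\<forall>t. 0 \<le> t \<longrightarrow> t < T \<longrightarrow> 0 < g t)"
proof -
  let ?B = "{0..} \<inter> g -` {..0}"
  have "closed ?B"
    using cont by (intro continuous_closed_preimage) auto
  moreover have "r \<in> ?B" using r by auto
  moreover have bdd: "bdd_below ?B" by (auto intro: bdd_belowI[of _ 0])
  ultimately have "Inf ?B \<in> ?B" using closed_contains_Inf[of ?B] by blast
  then have T: "0 \<le> Inf ?B" "g (Inf ?B) \<le> 0" by auto
  have before: "0 < g t" if "0 \<le> t" "t < Inf ?B" for t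
  proof (rule ccontr)
    assume "\<not> 0 < g t"
    then have "t \<in> ?B" using that by auto
    then have "Inf ?B \<le> t" using bdd by (rule cInf_lower)
    then show False using that by simp
  qed
  have "0 < Inf ?B" using T init by (cases "Inf ?B = 0") auto
  moreover have "g (Inf ?B) = 0"
  proof (rule ccontr)
    assume "g (Inf ?B) \<noteq> 0"
    then obtain z where "0 \<le> z" "z \<le> Inf ?B" "g z = 0"
      using IVT2'[of g "Inf ?B" 0 0] T init continuous_on_subset[OF cont, of "{0..Inf ?B}"] by auto
    then show False using before[of z] \<open>g (Inf ?B) \<noteq> 0\<close> by (cases "z = Inf ?B") auto
  qed
  ultimately show ?thesis using before by blast
qed

text \<open>
  Here \<open>d\<close> stands for an upper minus a lower function and \<open>s1\<close>, \<open>s2\<close> for their fronts. As long as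
  the fronts are apart, \<open>parabolic_positivity\<close> keeps \<open>d\<close> positive. When they first meet, \<open>d\<close> vanishes
  at the common front and is nonnegative to its left, so \<open>dx \<le> 0\<close> there; the strict Stefan
  inequality makes the gap \<open>s2 - s1\<close> increase at that moment, although it has just shrunk to zero.
  Only the difference of the two solutions enters, so the barrier can take either role.
\<close>

lemma free_boundary_comparison:
  fixes s1 s2 g' :: "real \<Rightarrow> real" and d dx dxx dt :: "real \<Rightarrow> real \<Rightarrow> real"
  assumes s_cont: "continuous_on {0..} s1" "continuous_on {0..} s2"
    and s_pos: "\<And>t. 0 \<le> t \<Longrightarrow> 0 < s1 t"
    and s_init: "s1 0 < s2 0"
    and d_cont: "continuous_on {(x, t). 0 \<le> t \<and> 0 \<le> x \<and> x \<le> s1 t \<and> x \<le> s2 t} (\<lambda>(x, t). d x t)"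
    and init: "\<And>x. 0 \<le> x \<Longrightarrow> x \<le> s1 0 \<Longrightarrow> 0 < d x 0"
    and dx: "\<And>x t. 0 < t \<Longrightarrow> s1 t \<le> s2 t \<Longrightarrow> 0 \<le> x \<Longrightarrow> x \<le> s1 t \<Longrightarrow>
        ((\<lambda>y. d y t) has_real_derivative dx x t) (at x within {0..s1 t})"
    and dxx: "\<And>x t. 0 < t \<Longrightarrow> s1 t < s2 t \<Longrightarrow> 0 < x \<Longrightarrow> x < s1 t \<Longrightarrow>
        ((\<lambda>y. dx y t) has_real_derivative dxx x t) (at x)"
    and dt: "\<And>x t. 0 < t \<Longrightarrow> s1 t < s2 t \<Longrightarrow> 0 < x \<Longrightarrow> x < s1 t \<Longrightarrow>
        ((\<lambda>r. d x r) has_real_derivative dt x t) (at t)"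
    and heat: "\<And>x t. 0 < t \<Longrightarrow> s1 t < s2 t \<Longrightarrow> 0 < x \<Longrightarrow> x < s1 t \<Longrightarrow> dxx x t < dt x t"
    and left: "\<And>t. 0 < t \<Longrightarrow> s1 t < s2 t \<Longrightarrow> dx 0 t < 0"
    and right: "\<And>t. 0 < t \<Longrightarrow> s1 t < s2 t \<Longrightarrow> 0 < d (s1 t) t \<or> 0 < dx (s1 t) t"
    and contact: "\<And>t. 0 < t \<Longrightarrow> s1 t = s2 t \<Longrightarrow> d (s1 t) t = 0"
    and speed: "\<And>t. 0 < t \<Longrightarrow> ((\<lambda>r. s2 r - s1 r) has_real_derivative g' t) (at t)"
    and stefan: "\<And>t. 0 < t \<Longrightarrow> s1 t = s2 t \<Longrightarrow> - dx (s1 t) t < g' t"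
    and t: "0 \<le> t"
  shows "s1 t < s2 t" and "\<And>x. 0 \<le> x \<Longrightarrow> x \<le> s1 t \<Longrightarrow> 0 < d x t"
proof -
  let ?D = "{(x, t). 0 \<le> t \<and> 0 \<le> x \<and> x \<le> s1 t \<and> x \<le> s2 t}"
  have pos: "0 < d x r" if sep: "\<And>r. 0 \<le> r \<Longrightarrow> r < T \<Longrightarrow> s1 r < s2 r"
    and r: "0 \<le> r" "r < T" "0 \<le> x" "x \<le> s1 r" for T r x
  proof (rule parabolic_positivity[where T = T and d = d and s = s1 and dx = dx and dxx = dxx and dt = dt])
    show "continuous_on {0..<T} s1"
      using s_cont(1) by (rule continuous_on_subset) auto
    show "continuous_on {(x, t). 0 \<le> t \<and> t < T \<and> 0 \<le> x \<and> x \<le> s1 t} (\<lambda>(x, t). d x t)"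
      using d_cont by (rule continuous_on_subset) (use sep in fastforce)
  qed (use s_pos init dx dxx dt heat left right sep r in \<open>auto simp: less_imp_le\<close>)
  have sep: "s1 r < s2 r" if r: "0 \<le> r" for r
  proof (rule ccontr)
    assume "\<not> s1 r < s2 r"
    then obtain T where "0 < T" "s2 T - s1 T = 0"
        and "\<And>q. 0 \<le> q \<Longrightarrow> q < T \<Longrightarrow> 0 < s2 q - s1 q"
      using first_nonpositive_time[OF continuous_on_diff[OF s_cont(2,1)], of r] s_init r
      by auto
    then have eq: "s1 T = s2 T" and less: "\<And>q. 0 \<le> q \<Longrightarrow> q < T \<Longrightarrow> s1 q < s2 q" by auto
    have cont_at: "(f \<longlongrightarrow> f T) (at_left T)" if "continuous_on {0..} f" for f :: "real \<Rightarrow> real"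
    proof -
      have "isCont f T"
        using that \<open>0 < T\<close> by (intro continuous_on_interior[where S = "{0..}"]) auto
      then show ?thesis by (simp add: isCont_def filterlim_at_split)
    qed
    have left_nbhd: "eventually (\<lambda>q. 0 < q \<and> q < T) (at_left T)"
      using eventually_at_left_real[OF \<open>0 < T\<close>] by (auto elim: eventually_mono)
    have nonneg: "0 \<le> d x T" if "0 < x" "x < s1 T" for x
    proof (rule nonneg_at_left_limit[OF d_cont])
      show "(x, T) \<in> ?D" using that \<open>0 < T\<close> eq by auto
      show "eventually (\<lambda>q. (x, q) \<in> ?D \<and> 0 \<le> d x q) (at_left T)"
        using left_nbhd order_tendstoD(1)[OF cont_at[OF s_cont(1)] that(2)]
      proof eventually_elim
        case (elim q)
        then have "s1 q < s2 q" "0 < d x q"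
          using less[of q] pos[OF less, of T q x] that by auto
        then show ?case using elim that by auto
      qed
    qed
    have "dx (s1 T) T \<le> 0"
    proof (rule ccontr)
      assume "\<not> dx (s1 T) T \<le> 0"
      then obtain e where e: "0 < e"
          "\<And>k. 0 < k \<Longrightarrow> s1 T - k \<in> {0..s1 T} \<Longrightarrow> k < e \<Longrightarrow> d (s1 T - k) T < d (s1 T) T"
        using has_real_derivative_pos_inc_left[OF dx[of T "s1 T"]] \<open>0 < T\<close> eq s_pos[of T] by auto
      define k where "k = min e (s1 T) / 2"
      have "0 < k" "k < e" "k < s1 T"
        using e s_pos[of T] \<open>0 < T\<close> by (auto simp: k_def min_def field_simps)
      then show False
        using e(2)[of k] nonneg[of "s1 T - k"] contact[OF \<open>0 < T\<close> eq] by auto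
    qed
    then have "0 < g' T" using stefan[OF \<open>0 < T\<close> eq] by simp
    then obtain e where e: "0 < e" "\<And>k. 0 < k \<Longrightarrow> k < e \<Longrightarrow> s2 (T - k) - s1 (T - k) < s2 T - s1 T"
      using DERIV_pos_inc_left[OF speed[OF \<open>0 < T\<close>]] by auto
    define k where "k = min e T / 2"
    have "0 < k" "k < e" "k < T" using e \<open>0 < T\<close> by (auto simp: k_def min_def field_simps)
    then show False using e(2)[of k] less[of "T - k"] eq by auto
  qed
  then show "s1 t < s2 t" using t by simp
  show "0 < d x t" if "0 \<le> x" "x \<le> s1 t" for x
    using pos[of "t + 1" t x] sep t that by auto
qed


section \<open>The self-similar profile and its barriers\<close>

definition gauss_primitive :: "real \<Rightarrow> real" where
  "gauss_primitive = (SOME E. \<forall>y. (E has_real_derivative exp (- (y\<^sup>2) / 4)) (at y))"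

lemma gauss_primitive_deriv:
  "(gauss_primitive has_real_derivative exp (- (y\<^sup>2) / 4)) (at y)"
proof -
  have "\<exists>F. \<forall>y::real. - \<infinity> < ereal y \<longrightarrow> ereal y < \<infinity> \<longrightarrow>
      (F has_vector_derivative exp (- (y\<^sup>2) / 4)) (at y)"
    by (rule einterval_antiderivative) (auto intro!: continuous_intros)
  then have "\<exists>E. \<forall>y::real. (E has_real_derivative exp (- (y\<^sup>2) / 4)) (at y)"
    by (auto simp: has_real_derivative_iff_has_vector_derivative)
  then have "\<forall>y. (gauss_primitive has_real_derivative exp (- (y\<^sup>2) / 4)) (at y)"
    unfolding gauss_primitive_def by (rule someI_ex)
  then show ?thesis by blast
qed

lemma gauss_primitive_bounds:
  assumes "a \<le> b"
  shows "0 \<le> gauss_primitive b - gauss_primitive a"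
    and "gauss_primitive b - gauss_primitive a \<le> b - a"
proof -
  have "0 \<le> gauss_primitive b - gauss_primitive a \<and>
      gauss_primitive b - gauss_primitive a \<le> b - a"
  proof (cases "a = b")
    case False
    with assms obtain z where
      "gauss_primitive b - gauss_primitive a = (b - a) * exp (- (z\<^sup>2) / 4)"
      using MVT2[of a b gauss_primitive "\<lambda>y. exp (- (y\<^sup>2) / 4)"] gauss_primitive_deriv by auto
    then show ?thesis
      using assms by (auto intro: mult_left_le)
  qed simp
  then show "0 \<le> gauss_primitive b - gauss_primitive a"
    and "gauss_primitive b - gauss_primitive a \<le> b - a" by auto
qed

lemma stefan_profile_eq:
  assumes "\<eta> \<le> stefan_omega h"
  shows "stefan_profile h \<eta> = h * (gauss_primitive (stefan_omega h) - gauss_primitive \<eta>)"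
proof -
  have "((\<lambda>r. exp (- (r\<^sup>2) / 4)) has_integral
      gauss_primitive (stefan_omega h) - gauss_primitive \<eta>) {\<eta>..stefan_omega h}"
    using assms gauss_primitive_deriv
    by (intro fundamental_theorem_of_calculus)
      (auto simp flip: has_real_derivative_iff_has_vector_derivative
        intro: DERIV_subset)
  then show ?thesis by (simp add: stefan_profile_def integral_unique)
qed

lemma stefan_omega:
  assumes "0 < h"
  shows "0 < stefan_omega h"
    and "h * exp (- ((stefan_omega h)\<^sup>2) / 4) = stefan_omega h / 2"
proof -
  have "0 < stefan_omega h \<and> h = stefan_omega h / 2 * exp ((stefan_omega h)\<^sup>2 / 4)"
    unfolding stefan_omega_def by (rule theI'[OF stefan_omega_ex1[OF assms]])
  then have w: "0 < stefan_omega h" "h = stefan_omega h / 2 * exp ((stefan_omega h)\<^sup>2 / 4)"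
    by blast+
  show "0 < stefan_omega h" by fact
  have "h * exp (- ((stefan_omega h)\<^sup>2) / 4) =
      stefan_omega h / 2 * (exp ((stefan_omega h)\<^sup>2 / 4) * exp (- ((stefan_omega h)\<^sup>2) / 4))"
    by (subst w(2)) simp
  also have "\<dots> = stefan_omega h / 2"
    by (simp flip: exp_add)
  finally show "h * exp (- ((stefan_omega h)\<^sup>2) / 4) = stefan_omega h / 2" .
qed

text \<open>
  An antiderivative in \<open>\<eta>\<close> of the flux \<open>barrier_slope\<close>; the corrected profile with front at \<open>l\<close> is its
  increment from \<open>\<eta>\<close> to \<open>l\<close>, so all derivatives of the barrier come from the chain rule.
\<close>

definition barrier_primitive :: "real \<Rightarrow> real \<Rightarrow> real \<Rightarrow> real" where
  "barrier_primitive h \<kappa> \<eta> = h * gauss_primitive \<eta> + \<kappa> * (\<eta>\<^sup>2 / 2 + \<eta>)"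

definition barrier_profile :: "real \<Rightarrow> real \<Rightarrow> real \<Rightarrow> real \<Rightarrow> real" where
  "barrier_profile h \<kappa> l \<eta> = barrier_primitive h \<kappa> l - barrier_primitive h \<kappa> \<eta>"

definition barrier_slope :: "real \<Rightarrow> real \<Rightarrow> real \<Rightarrow> real" where
  "barrier_slope h \<kappa> \<eta> = h * exp (- (\<eta>\<^sup>2) / 4) + \<kappa> * (\<eta> + 1)"

text \<open>
  The solution of \<open>(t + 1) * l' = - m * (l - A)\<close> with \<open>l(0) = A + C\<close>: a front position in the
  similarity variable that relaxes to \<open>A\<close>, at a rate \<open>m\<close> that can be made as small as needed.
\<close>

definition barrier_radius :: "real \<Rightarrow> real \<Rightarrow> real \<Rightarrow> real \<Rightarrow> real" where
  "barrier_radius A C m t = A + C * (t + 1) powr (- m)"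

definition barrier :: "real \<Rightarrow> real \<Rightarrow> real \<Rightarrow> real \<Rightarrow> real \<Rightarrow> real \<Rightarrow> real \<Rightarrow> real" where
  "barrier h \<kappa> A C m x t = barrier_profile h \<kappa> (barrier_radius A C m t) (x / sqrt (t + 1))"

definition barrier_t :: "real \<Rightarrow> real \<Rightarrow> real \<Rightarrow> real \<Rightarrow> real \<Rightarrow> real \<Rightarrow> real \<Rightarrow> real" where
  "barrier_t h \<kappa> A C m x t =
     (barrier_slope h \<kappa> (x / sqrt (t + 1)) * (x / sqrt (t + 1)) / 2 -
      m * (barrier_radius A C m t - A) * barrier_slope h \<kappa> (barrier_radius A C m t)) / (t + 1)"

definition front_speed :: "real \<Rightarrow> real \<Rightarrow> real \<Rightarrow> real \<Rightarrow> real" where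
  "front_speed A C m t =
     (barrier_radius A C m t / 2 - m * (barrier_radius A C m t - A)) / sqrt (t + 1)"

lemma sqrt_shift:
  fixes t :: real
  assumes "0 \<le> t"
  obtains q where "0 < q" "sqrt (t + 1) = q" "t + 1 = q * q"
  using assms by (metis add_nonneg_pos real_sqrt_gt_zero real_sqrt_mult_self abs_of_pos zero_less_one)

lemma barrier_radius_deriv:
  assumes "0 \<le> t"
  shows "(barrier_radius A C m has_real_derivative - m * (barrier_radius A C m t - A) / (t + 1)) (at t)"
proof -
  have pos: "0 < t + 1" using assms by simp
  then have eq: "(t + 1) powr (- m - 1) = (t + 1) powr (- m) / (t + 1)"
    by (simp add: powr_diff)
  have "((\<lambda>r. (r + 1) powr (- m)) has_real_derivative - m * (t + 1) powr (- m - 1) * 1) (at t)"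
    using pos by (intro DERIV_fun_powr[THEN DERIV_cong] derivative_eq_intros) auto
  then have "((\<lambda>r. A + C * (r + 1) powr (- m)) has_real_derivative
      C * (- m * (t + 1) powr (- m - 1) * 1)) (at t)"
    by (intro DERIV_cong[OF DERIV_add[OF DERIV_const DERIV_cmult]]) auto
  then show ?thesis
    unfolding barrier_radius_def[abs_def] by (rule DERIV_cong) (simp add: eq)
qed

lemma similarity_variable_deriv:
  assumes "0 \<le> t"
  shows "((\<lambda>r. x / sqrt (r + 1)) has_real_derivative - (x / sqrt (t + 1)) / (2 * (t + 1))) (at t)"
proof -
  have "sqrt (t + 1) * sqrt (t + 1) = t + 1" using assms by simp
  then show ?thesis
    using assms
    by (auto intro!: derivative_eq_intros simp: field_simps)
qed

lemma barrier_front_deriv: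
  assumes "0 \<le> t"
  shows "((\<lambda>r. barrier_radius A C m r * sqrt (r + 1)) has_real_derivative front_speed A C m t) (at t)"
proof -
  obtain q where q: "0 < q" "sqrt (t + 1) = q" "t + 1 = q * q"
    using sqrt_shift[OF assms] .
  have "((\<lambda>r. sqrt (r + 1)) has_real_derivative 1 / (2 * q)) (at t)"
    using assms by (auto intro!: derivative_eq_intros simp: field_simps simp flip: q(2))
  note deriv = DERIV_mult[OF barrier_radius_deriv[OF assms] this, unfolded q(2), unfolded q(3)]
  have "- m * (R - A) / (q * q) * q + 1 / (2 * q) * R = (R / 2 - m * (R - A)) / q" for R
    using q(1) by (simp add: field_simps)
  then show ?thesis
    unfolding front_speed_def q(2) by (rule DERIV_cong[OF deriv])
qed

lemma barrier_primitive_deriv: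
  "(barrier_primitive h \<kappa> has_real_derivative barrier_slope h \<kappa> \<eta>) (at \<eta>)"
  unfolding barrier_primitive_def[abs_def]
  by (auto intro!: derivative_eq_intros gauss_primitive_deriv simp: barrier_slope_def algebra_simps)

lemma barrier_profile_deriv:
  assumes "(l has_real_derivative l') (at t within S)" "(y has_real_derivative y') (at t within S)"
  shows "((\<lambda>r. barrier_profile h \<kappa> (l r) (y r)) has_real_derivative
      barrier_slope h \<kappa> (l t) * l' - barrier_slope h \<kappa> (y t) * y') (at t within S)"
  unfolding barrier_profile_def
  by (intro DERIV_diff DERIV_chain2[OF barrier_primitive_deriv] assms)

lemma barrier_x_deriv:
  "((\<lambda>y. barrier h \<kappa> A C m y t) has_real_derivative
      - barrier_slope h \<kappa> (x / sqrt (t + 1)) / sqrt (t + 1)) (at x)"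
  unfolding barrier_def
  by (rule DERIV_cong[OF barrier_profile_deriv[OF DERIV_const DERIV_cdivide[OF DERIV_ident]]]) simp

lemma barrier_continuous: "continuous_on (UNIV \<times> {0..}) (\<lambda>(x, t). barrier h \<kappa> A C m x t)"
proof -
  have E: "continuous_on UNIV (barrier_primitive h \<kappa>)"
    using barrier_primitive_deriv by (auto intro!: continuous_at_imp_continuous_on DERIV_isCont)
  have R: "continuous_on {0..} (barrier_radius A C m)"
    using barrier_radius_deriv
    by (auto intro!: continuous_at_imp_continuous_on DERIV_isCont)
  have "continuous_on (UNIV \<times> {0..}) (\<lambda>p :: real \<times> real. barrier_radius A C m (snd p))"
    by (rule continuous_on_compose2[OF R]) (auto intro: continuous_intros)
  moreover have "continuous_on (UNIV \<times> {0..}) (\<lambda>p :: real \<times> real. fst p / sqrt (snd p + 1))"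
    by (intro continuous_intros) auto
  ultimately show ?thesis
    unfolding case_prod_unfold barrier_def barrier_profile_def
    by (intro continuous_on_diff continuous_on_compose2[OF E]) auto
qed

lemma barrier_xx_deriv:
  assumes "0 \<le> t"
  shows "((\<lambda>y. - barrier_slope h \<kappa> (y / sqrt (t + 1)) / sqrt (t + 1)) has_real_derivative
      (h * (x / sqrt (t + 1)) / 2 * exp (- ((x / sqrt (t + 1))\<^sup>2) / 4) - \<kappa>) / (t + 1)) (at x)"
proof -
  obtain q where q: "0 < q" "sqrt (t + 1) = q" "t + 1 = q * q"
    using sqrt_shift[OF assms] .
  have slope: "(barrier_slope h \<kappa> has_real_derivative
      \<kappa> - h * \<eta> / 2 * exp (- (\<eta>\<^sup>2) / 4)) (at \<eta>)" for \<eta>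
    unfolding barrier_slope_def[abs_def]
    by (auto intro!: derivative_eq_intros simp: algebra_simps)
  show ?thesis
    unfolding q(2) unfolding q(3)
    by (rule DERIV_cong[OF DERIV_cdivide[OF DERIV_minus[OF
            DERIV_chain2[OF slope DERIV_cdivide[OF DERIV_ident]]]]])
      (use q(1) in \<open>simp add: field_simps\<close>)
qed

lemma barrier_t_deriv:
  assumes "0 \<le> t"
  shows "((\<lambda>r. barrier h \<kappa> A C m x r) has_real_derivative barrier_t h \<kappa> A C m x t) (at t)"
proof -
  have "a * (- m * r / T) - b * (- y / (2 * T)) = (b * y / 2 - m * r * a) / T" for a b r y T :: real
    by (cases "T = 0") (simp_all add: field_simps)
  then show ?thesis
    unfolding barrier_def barrier_t_def
    by (intro DERIV_cong[OF barrier_profile_deriv[OF barrier_radius_deriv[OF assms]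
            similarity_variable_deriv[OF assms]]])
qed

text \<open>
  The self-similar part solves the heat equation exactly. What remains is the correction, which for
  \<open>x \<ge> 0\<close> has the sign of \<open>\<kappa>\<close>, and the motion of the front, of order \<open>m\<close>; so for small \<open>m\<close> the sign of \<open>\<kappa>\<close> decides
  between super- and subsolution.
\<close>

lemma barrier_heat_defect:
  fixes x t :: real
  assumes "0 \<le> t"
  defines "\<eta> \<equiv> x / sqrt (t + 1)"
  shows "barrier_t h \<kappa> A C m x t - (h * \<eta> / 2 * exp (- (\<eta>\<^sup>2) / 4) - \<kappa>) / (t + 1) =
     (\<kappa> * (1 + (\<eta>\<^sup>2 + \<eta>) / 2) -
      m * (barrier_radius A C m t - A) * barrier_slope h \<kappa> (barrier_radius A C m t)) / (t + 1)"
  unfolding barrier_t_def \<eta>_def[symmetric]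
  by (simp add: barrier_slope_def field_simps power2_eq_square flip: diff_divide_distrib)

section \<open>Bounds for the barrier parameters\<close>

lemma barrier_radius_range:
  assumes "0 \<le> t" "0 \<le> m"
  shows "\<exists>\<theta>. 0 < \<theta> \<and> \<theta> \<le> 1 \<and> barrier_radius A C m t = A + C * \<theta>"
  using assms powr_mono[of "- m" 0 "t + 1"]
  by (intro exI[of _ "(t + 1) powr (- m)"]) (auto simp: barrier_radius_def)

lemma barrier_radius_tendsto:
  assumes "0 < m"
  shows "(barrier_radius A C m \<longlongrightarrow> A) at_top"
proof -
  have "filterlim (\<lambda>t::real. t + 1) at_top at_top"
    using filterlim_tendsto_add_at_top[OF tendsto_const[of 1] filterlim_ident]
    by (simp add: add.commute)
  then have "((\<lambda>t::real. (t + 1) powr (- m)) \<longlongrightarrow> 0) at_top"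
    using assms by (intro tendsto_neg_powr) auto
  then have "((\<lambda>t. A + C * (t + 1) powr (- m)) \<longlongrightarrow> A + C * 0) at_top"
    by (intro tendsto_intros)
  then show ?thesis by (simp add: barrier_radius_def[abs_def])
qed

text \<open>
  The strict front inequality of the supersolution. Beyond \<open>\<omega>\<close> the balance
  \<open>l / 2 - h * exp (- l\<^sup>2 / 4)\<close> is at least \<open>(l - \<omega>) / 2\<close>, since it vanishes at \<open>\<omega>\<close>; with the chosen
  \<open>\<kappa>\<close> and \<open>m \<le> 1 / 4\<close> the correction and the relaxation of \<open>l\<close> use up less than this.
\<close>

lemma upper_slope_bound:
  assumes h: "0 < h" and \<epsilon>: "0 < \<epsilon>" "\<epsilon> \<le> 1" and l: "stefan_omega h + \<epsilon> \<le> l" and m: "m \<le> 1 / 4"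
  shows "barrier_slope h (\<epsilon> / (8 * (stefan_omega h + 1))) l < l / 2 - m * (l - (stefan_omega h + \<epsilon>))"
proof -
  define \<omega> where "\<omega> = stefan_omega h"
  define \<kappa> where "\<kappa> = \<epsilon> / (8 * (\<omega> + 1))"
  have \<omega>: "0 < \<omega>" "h * exp (- (\<omega>\<^sup>2) / 4) = \<omega> / 2"
    using stefan_omega[OF h] by (simp_all add: \<omega>_def)
  have "\<epsilon> / (8 * a) * a = \<epsilon> / 8" if "0 < a" for a using that by simp
  then have \<kappa>: "0 \<le> \<kappa>" "\<kappa> * (\<omega> + 1) = \<epsilon> / 8"
    using \<omega> \<epsilon> unfolding \<kappa>_def by (auto simp del: distrib_left_numeral)
  have "\<kappa> * 1 \<le> \<kappa> * (\<omega> + 1)" using \<kappa> \<omega> by (intro mult_left_mono) auto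
  then have "\<kappa> \<le> 1 / 8" using \<kappa> \<epsilon> by simp
  then have "\<kappa> * (l - \<omega>) \<le> 1 / 8 * (l - \<omega>)"
    using l \<epsilon> by (intro mult_right_mono) (auto simp: \<omega>_def)
  moreover have "\<kappa> * (l + 1) = \<kappa> * (l - \<omega>) + \<epsilon> / 8"
    using \<kappa>(2) by (simp add: algebra_simps)
  moreover have "m * (l - (\<omega> + \<epsilon>)) \<le> 1 / 4 * (l - (\<omega> + \<epsilon>))"
    using l m by (intro mult_right_mono) (auto simp: \<omega>_def)
  moreover have "h * exp (- (l\<^sup>2) / 4) \<le> h * exp (- (\<omega>\<^sup>2) / 4)"
    using h l \<omega> \<epsilon> by (intro mult_left_mono) (auto simp: \<omega>_def intro!: power_mono)
  moreover have "P + R < l / 2 - M"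
    if "K \<le> 1 / 8 * (l - \<omega>)" "R = K + \<epsilon> / 8" "M \<le> 1 / 4 * (l - (\<omega> + \<epsilon>))" "P \<le> \<omega> / 2" for K R M P
    using that l \<epsilon> unfolding \<omega>_def[symmetric] by (simp add: field_simps)
  ultimately have "h * exp (- (l\<^sup>2) / 4) + \<kappa> * (l + 1) < l / 2 - m * (l - (\<omega> + \<epsilon>))"
    unfolding \<omega>(2) by blast
  then show ?thesis by (simp add: barrier_slope_def \<kappa>_def \<omega>_def)
qed

text \<open>The mirror image below \<open>\<omega>\<close>, where the balance is at most \<open>- (\<omega> - l) / 2\<close>.\<close>

lemma lower_slope_bound:
  assumes h: "0 < h" and \<epsilon>: "0 < \<epsilon>" and l: "0 \<le> l" "l \<le> stefan_omega h - \<epsilon>" and m: "m \<le> 1 / 4"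
  shows "l / 2 - m * (l - (stefan_omega h - \<epsilon>)) < barrier_slope h (- (\<epsilon> / (8 * (stefan_omega h + 1)))) l"
proof -
  define \<omega> where "\<omega> = stefan_omega h"
  define \<kappa> where "\<kappa> = \<epsilon> / (8 * (\<omega> + 1))"
  have \<omega>: "0 < \<omega>" "h * exp (- (\<omega>\<^sup>2) / 4) = \<omega> / 2"
    using stefan_omega[OF h] by (simp_all add: \<omega>_def)
  have "\<epsilon> / (8 * a) * a = \<epsilon> / 8" if "0 < a" for a using that by simp
  then have \<kappa>: "0 \<le> \<kappa>" "\<kappa> * (\<omega> + 1) = \<epsilon> / 8"
    using \<omega> \<epsilon> unfolding \<kappa>_def by (auto simp del: distrib_left_numeral)
  have "\<kappa> * (l + 1) \<le> \<kappa> * (\<omega> + 1)"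
    using \<kappa> l \<epsilon> by (intro mult_left_mono) (auto simp: \<omega>_def)
  moreover have "m * ((\<omega> - \<epsilon>) - l) \<le> 1 / 4 * ((\<omega> - \<epsilon>) - l)"
    using l m by (intro mult_right_mono) (auto simp: \<omega>_def)
  moreover have "m * (l - (\<omega> - \<epsilon>)) = - (m * ((\<omega> - \<epsilon>) - l))" by (simp add: algebra_simps)
  moreover have "h * exp (- (\<omega>\<^sup>2) / 4) \<le> h * exp (- (l\<^sup>2) / 4)"
    using h l \<omega> \<epsilon> by (intro mult_left_mono) (auto simp: \<omega>_def intro!: power_mono)
  moreover have "l / 2 - M < P - R"
    if "R \<le> \<epsilon> / 8" "N \<le> 1 / 4 * ((\<omega> - \<epsilon>) - l)" "M = - N" "\<omega> / 2 \<le> P" for R M N P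
    using that l \<epsilon> unfolding \<omega>_def[symmetric] by (simp add: field_simps)
  ultimately have "l / 2 - m * (l - (\<omega> - \<epsilon>)) < h * exp (- (l\<^sup>2) / 4) - \<kappa> * (l + 1)"
    unfolding \<omega>(2) \<kappa>(2) by blast
  then show ?thesis by (simp add: barrier_slope_def \<kappa>_def \<omega>_def)
qed

text \<open>
  Moving the front by at most \<open>2 * \<epsilon>\<close> costs \<open>2 * h * \<epsilon>\<close>, as the Gaussian is at most \<open>1\<close>; the
  correction costs at most \<open>\<epsilon> * (\<omega> + 2)\<close> because of the size of \<open>\<kappa>\<close>. The absolute value of \<open>\<kappa>\<close> lets
  the estimate serve both barriers.
\<close>

lemma barrier_profile_gap:
  assumes h: "0 < h" and \<epsilon>: "0 < \<epsilon>" "\<epsilon> \<le> 1" and \<eta>: "0 \<le> \<eta>" "\<eta> \<le> l" "\<eta> \<le> stefan_omega h"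
    and l: "\<bar>l - stefan_omega h\<bar> \<le> 2 * \<epsilon>"
    and \<kappa>: "\<bar>\<kappa>\<bar> = \<epsilon> / (8 * (stefan_omega h + 1))"
  shows "\<bar>barrier_profile h \<kappa> l \<eta> - stefan_profile h \<eta>\<bar> \<le> \<epsilon> * (2 * h + stefan_omega h + 2)"
proof -
  define \<omega> where "\<omega> = stefan_omega h"
  have \<omega>: "0 < \<omega>" using stefan_omega[OF h] by (simp add: \<omega>_def)
  have "\<bar>gauss_primitive l - gauss_primitive \<omega>\<bar> \<le> 2 * \<epsilon>"
    using gauss_primitive_bounds[of l \<omega>] gauss_primitive_bounds[of \<omega> l] l
    by (cases "l \<le> \<omega>") (auto simp: \<omega>_def)
  then have "h * \<bar>gauss_primitive l - gauss_primitive \<omega>\<bar> \<le> h * (2 * \<epsilon>)"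
    using h by (intro mult_left_mono) auto
  then have 1: "\<bar>h * (gauss_primitive l - gauss_primitive \<omega>)\<bar> \<le> 2 * h * \<epsilon>"
    using h by (simp add: abs_mult)
  have sq: "0 \<le> l\<^sup>2 - \<eta>\<^sup>2" using \<eta> by (auto intro: power_mono)
  have "\<bar>\<kappa>\<bar> * ((l\<^sup>2 - \<eta>\<^sup>2) / 2 + (l - \<eta>)) \<le> \<bar>\<kappa>\<bar> * (8 * (\<omega> + 1) * (\<omega> + 2))"
  proof (rule mult_left_mono)
    have "(l\<^sup>2 - \<eta>\<^sup>2) / 2 + (l - \<eta>) \<le> l * (l / 2 + 1)"
      using \<eta> by (simp add: power2_eq_square field_simps)
    also have "\<dots> \<le> (\<omega> + 2) * (8 * (\<omega> + 1))"
      using \<eta> l \<epsilon> \<omega> by (intro mult_mono) (auto simp: \<omega>_def)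
    finally show "(l\<^sup>2 - \<eta>\<^sup>2) / 2 + (l - \<eta>) \<le> 8 * (\<omega> + 1) * (\<omega> + 2)" by (simp add: mult_ac)
  qed simp
  also have "\<dots> = \<epsilon> * (\<omega> + 2)"
    using \<omega> unfolding \<kappa> \<omega>_def[symmetric] by simp
  finally have 2: "\<bar>\<kappa> * ((l\<^sup>2 - \<eta>\<^sup>2) / 2 + (l - \<eta>))\<bar> \<le> \<epsilon> * (\<omega> + 2)"
    using sq \<eta> by (simp add: abs_mult)
  have "barrier_profile h \<kappa> l \<eta> - stefan_profile h \<eta> =
      h * (gauss_primitive l - gauss_primitive \<omega>) + \<kappa> * ((l\<^sup>2 - \<eta>\<^sup>2) / 2 + (l - \<eta>))"
    using stefan_profile_eq[OF \<eta>(3)]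
    by (simp add: barrier_profile_def barrier_primitive_def \<omega>_def field_simps)
  then show ?thesis
    using 1 2 unfolding \<omega>_def[symmetric] by (simp add: algebra_simps)
qed

section \<open>Classical solutions between barriers\<close>

locale stefan_flow =
  fixes h b0 :: real and u0 s s' :: "real \<Rightarrow> real" and u ux uxx ut :: "real \<Rightarrow> real \<Rightarrow> real"
  assumes h_pos: "0 < h" and b0_pos: "0 < b0"
    and u0_cont: "continuous_on {0..} u0" and u0_nonneg: "\<And>x. 0 \<le> x \<Longrightarrow> 0 \<le> u0 x"
    and u0_origin: "0 < u0 0"
    and s_C1: "C1_with_deriv s s'"
    and u_C21: "C21_with_derivs (stefan_interior s) u ux uxx ut"
    and u_cont: "continuous_on (stefan_closed s) (\<lambda>(x, t). u x t)"
    and ux_closed: "\<forall>(x, t)\<in>stefan_closed_pos s.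
           ((\<lambda>y. u y t) has_real_derivative ux x t) (at x within {0..s t})"
    and heat_eq: "\<forall>(x, t)\<in>stefan_interior s. ut x t - uxx x t = 0"
    and flux: "\<forall>t>0. - ux 0 t = h / sqrt (t + 1)"
    and front_zero: "\<forall>t>0. u (s t) t = 0"
    and stefan_condition: "\<forall>t>0. s' t = - ux (s t) t"
    and s_init: "s 0 = b0"
    and u_init: "\<forall>x. 0 < x \<and> x < b0 \<longrightarrow> u x 0 = u0 x"
begin

lemma s_deriv:
  assumes "0 < t"
  shows "(s has_real_derivative s' t) (at t)"
proof -
  have "(s has_real_derivative s' t) (at t within {0..})"
    using s_C1 assms by (simp add: C1_with_deriv_def)
  then show ?thesis
    using at_within_interior[of t "{0..}"] assms by simp
qed

lemma s_cont: "continuous_on {0..} s"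
  using s_C1 by (auto simp: C1_with_deriv_def intro: DERIV_continuous_on)

lemma ux_deriv:
  "0 < t \<Longrightarrow> 0 \<le> x \<Longrightarrow> x \<le> s t \<Longrightarrow>
    ((\<lambda>y. u y t) has_real_derivative ux x t) (at x within {0..s t})"
  using ux_closed by (auto simp: stefan_closed_pos_def)

lemma interior_derivs:
  assumes "0 < t" "0 < x" "x < s t"
  shows "((\<lambda>y. u y t) has_real_derivative ux x t) (at x)"
    and "((\<lambda>y. ux y t) has_real_derivative uxx x t) (at x)"
    and "((\<lambda>r. u x r) has_real_derivative ut x t) (at t)"
    and "ut x t = uxx x t"
  using u_C21 heat_eq assms by (auto simp: C21_with_derivs_def stefan_interior_def)

text \<open>
  The data are prescribed for \<open>0 < x < b0\<close> only; continuity of \<open>u\<close> up to the boundary carries them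
  to the two endpoints.
\<close>

lemma initial_value:
  assumes "0 \<le> x" "x \<le> b0"
  shows "u x 0 = u0 x"
proof -
  have closure: "closure {0<..<b0} = {0..b0}" using b0_pos by simp
  have "continuous_on {0..b0} (\<lambda>x. u x 0)"
    using continuous_on_compose2[OF u_cont, of "{0..b0}" "\<lambda>x. (x, 0)"] s_init
    by (force simp: stefan_closed_def intro!: continuous_intros)
  moreover have "continuous_on {0..b0} u0"
    using u0_cont by (rule continuous_on_subset) auto
  ultimately have "continuous_on (closure {0<..<b0}) (\<lambda>x. u x 0 - u0 x)"
    unfolding closure by (intro continuous_intros)
  then have "u x 0 - u0 x = 0"
    by (rule continuous_constant_on_closure) (use u_init assms closure in auto)
  then show ?thesis by simp
qed

text \<open>
  Adding \<open>k * (t + 1)\<close> makes the heat equation strict and the values at time \<open>0\<close> and at the front positive.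
\<close>

lemma nonneg_while_front_positive:
  assumes pos: "\<And>t. 0 \<le> t \<Longrightarrow> t < T \<Longrightarrow> 0 < s t"
    and pt: "0 \<le> t" "t < T" "0 \<le> x" "x \<le> s t"
  shows "0 \<le> u x t"
proof (rule field_le_epsilon)
  fix e :: real assume "0 < e"
  define k where "k = e / (t + 1)"
  have k: "0 < k" using \<open>0 < e\<close> pt by (simp add: k_def)
  have "0 < u x t + k * (t + 1)"
  proof (rule parabolic_positivity[where T = T and s = s and ?t0.0 = t and ?x0.0 = x
        and d = "\<lambda>x t. u x t + k * (t + 1)" and dx = ux and dxx = uxx and dt = "\<lambda>x t. ut x t + k"])
    show "continuous_on {0..<T} s"
      using s_cont by (rule continuous_on_subset) auto
    have "continuous_on {(x, t). 0 \<le> t \<and> t < T \<and> 0 \<le> x \<and> x \<le> s t} (\<lambda>(x, t). u x t)"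
      using u_cont by (rule continuous_on_subset) (auto simp: stefan_closed_def)
    then show "continuous_on {(x, t). 0 \<le> t \<and> t < T \<and> 0 \<le> x \<and> x \<le> s t}
        (\<lambda>(x, t). u x t + k * (t + 1))"
      unfolding case_prod_unfold by (intro continuous_intros)
    show "0 < u y 0 + k * (0 + 1)" if "0 \<le> y" "y \<le> s 0" for y
      using initial_value[of y] u0_nonneg[of y] that s_init k by simp
    show "((\<lambda>y. u y r + k * (r + 1)) has_real_derivative ux y r) (at y within {0..s r})"
      if "0 < r" "0 \<le> y" "y \<le> s r" for y r
      using DERIV_add[OF ux_deriv[OF that] DERIV_const] by simp
    show "((\<lambda>r. u y r + k * (r + 1)) has_real_derivative ut y r + k) (at r)"
      if "0 < r" "0 < y" "y < s r" for y r
      using interior_derivs(3)[OF that] by (auto intro!: derivative_eq_intros)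
    show "ux 0 r < 0" if "0 < r" for r
    proof -
      have "0 < h / sqrt (r + 1)" using h_pos that by simp
      then show ?thesis using flux that by fastforce
    qed
    show "0 < u (s r) r + k * (r + 1) \<or> 0 < ux (s r) r" if "0 < r" for r
      using front_zero that k by simp
  qed (use pos pt interior_derivs k in auto)
  also have "k * (t + 1) = e" using pt by (simp add: k_def)
  finally show "0 \<le> u x t + e" by simp
qed

text \<open>
  Up to the first time at which the front would reach \<open>0\<close>, the solution is nonnegative and vanishes
  at the front, so \<open>ux \<le> 0\<close> there and the front cannot have receded from \<open>b0\<close>.
\<close>

lemma front_positive:
  assumes "0 \<le> t"
  shows "0 < s t"
proof (rule ccontr)
  assume "\<not> 0 < s t"
  then obtain T where T: "0 < T" "s T = 0" "\<And>t. 0 \<le> t \<Longrightarrow> t < T \<Longrightarrow> 0 < s t"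
    using first_nonpositive_time[OF s_cont, of t] s_init b0_pos assms by auto
  obtain l z where z: "0 < z" "z < T" "(s has_real_derivative l) (at z)" "s T - s 0 = (T - 0) * l"
    using MVT[OF T(1), of s] continuous_on_subset[OF s_cont, of "{0..T}"] s_deriv
    by (auto simp: real_differentiable_def)
  have "l = s' z" using DERIV_unique[OF z(3) s_deriv[OF z(1)]] .
  moreover have "l < 0"
  proof (rule ccontr)
    assume "\<not> l < 0"
    then have "0 \<le> T * l" using T(1) by simp
    then show False using z(4) T(2) s_init b0_pos by simp
  qed
  ultimately have "0 < ux (s z) z" using stefan_condition z by auto
  then obtain e where e: "0 < e"
      "\<And>k. 0 < k \<Longrightarrow> s z - k \<in> {0..s z} \<Longrightarrow> k < e \<Longrightarrow> u (s z - k) z < u (s z) z"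
    using has_real_derivative_pos_inc_left[OF ux_deriv[of z "s z"]] z T(3)[of z] by auto
  define k where "k = min e (s z) / 2"
  have "0 < k" "k < e" "k < s z"
    using e T(3)[of z] z by (auto simp: k_def min_def field_simps)
  then show False
    using e(2)[of k] nonneg_while_front_positive[OF T(3), of T z "s z - k"] z front_zero by auto
qed

lemma nonneg: "0 \<le> t \<Longrightarrow> 0 \<le> x \<Longrightarrow> x \<le> s t \<Longrightarrow> 0 \<le> u x t"
  using nonneg_while_front_positive[of "t + 1" t x] front_positive by auto

lemma flux_value: "0 < t \<Longrightarrow> ux 0 t = - (h / sqrt (t + 1))"
  using flux by (metis add.inverse_inverse)

text \<open>
  The constants are fixed in the order \<open>\<epsilon>\<close>, \<open>\<kappa>\<close>, \<open>C\<close>, \<open>m\<close>: \<open>\<kappa>\<close> is small enough for the front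
  inequality at every \<open>l \<ge> \<omega> + \<epsilon>\<close>, \<open>C\<close> then large enough to put the barrier above \<open>u0\<close> by means
  of the correction alone, and finally \<open>m\<close> so small that moving the front does not spoil
  the heat inequality.
\<close>

lemma below_upper_barrier:
  assumes \<epsilon>: "0 < \<epsilon>" "\<epsilon> \<le> 1"
  defines "A \<equiv> stefan_omega h + \<epsilon>" and "\<kappa> \<equiv> \<epsilon> / (8 * (stefan_omega h + 1))"
  shows "\<exists>C>0. \<exists>m>0. \<forall>t\<ge>0. s t < barrier_radius A C m t * sqrt (t + 1) \<and>
    (\<forall>x. 0 \<le> x \<longrightarrow> x \<le> s t \<longrightarrow> u x t < barrier h \<kappa> A C m x t)"
proof -
  have \<omega>: "0 < stefan_omega h" using stefan_omega(1)[OF h_pos] .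
  have A: "0 < A" using \<omega> \<epsilon> by (simp add: A_def)
  have \<kappa>: "0 < \<kappa>" using \<omega> \<epsilon> by (simp add: \<kappa>_def)
  have "continuous_on {0..b0} u0" using u0_cont by (rule continuous_on_subset) auto
  then obtain z where "\<forall>x\<in>{0..b0}. u0 x \<le> u0 z" "z \<in> {0..b0}"
    using continuous_attains_sup[of "{0..b0}" u0] b0_pos by auto
  then obtain M where M: "0 \<le> M" "\<And>x. 0 \<le> x \<Longrightarrow> x \<le> b0 \<Longrightarrow> u0 x \<le> M"
    using u0_nonneg[of z] by auto
  define C where "C = b0 + M / \<kappa> + 1"
  have C: "0 < C" "b0 < C" "M < \<kappa> * (C - b0)"
  proof -
    have "0 \<le> M / \<kappa>" using M \<kappa> by simp
    then show "0 < C" "b0 < C" using b0_pos by (auto simp: C_def)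
    show "M < \<kappa> * (C - b0)" using \<kappa> by (simp add: C_def field_simps)
  qed
  \<comment> \<open>A bound of the slope at all front positions between \<open>A\<close> and \<open>A + C\<close>.\<close>
  define S where "S = h + \<kappa> * (A + C + 1)"
  have S: "0 < S" using h_pos \<kappa> A C by (auto simp: S_def intro!: add_pos_pos)
  define m where "m = min (1 / 4) (\<kappa> / (2 * C * S))"
  have m: "0 < m" "m \<le> 1 / 4" "m * C * S < \<kappa>"
  proof -
    show "0 < m" "m \<le> 1 / 4" using \<kappa> C S by (auto simp: m_def)
    have "m * (C * S) \<le> \<kappa> / (2 * C * S) * (C * S)"
      using C S by (intro mult_right_mono) (auto simp: m_def)
    also have "\<dots> = \<kappa> / 2" using C S by (simp add: field_simps)
    finally show "m * C * S < \<kappa>" using \<kappa> by simp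
  qed
  define R where "R = barrier_radius A C m"
  define \<sigma> where "\<sigma> = (\<lambda>t. R t * sqrt (t + 1))"
  have R: "A < R t" "R t \<le> A + C" if "0 \<le> t" for t
    using barrier_radius_range[OF that, of m A C] m C that
    by (auto simp: R_def mult_left_le)
  have slope: "barrier_slope h \<kappa> (R t) < R t / 2 - m * (R t - A)" if "0 \<le> t" for t
    using upper_slope_bound[OF h_pos \<epsilon>, of "R t" m] R[OF that] m by (simp add: A_def \<kappa>_def)
  have slope_le: "barrier_slope h \<kappa> (R t) \<le> S" if "0 \<le> t" for t
    unfolding barrier_slope_def S_def
    using R[OF that] h_pos \<kappa> by (intro add_mono mult_left_mono) (auto intro: mult_left_le)
  have slope_pos: "0 < barrier_slope h \<kappa> y" if "0 \<le> y" for y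
    using that h_pos \<kappa> by (auto simp: barrier_slope_def intro!: add_pos_nonneg)
  have profile_pos: "\<kappa> * (l - y) \<le> barrier_profile h \<kappa> l y" if "0 \<le> y" "y \<le> l" for l y
  proof -
    have "0 \<le> l\<^sup>2 - y\<^sup>2" using that by (auto intro: power_mono)
    then have "0 \<le> \<kappa> * ((l\<^sup>2 - y\<^sup>2) / 2)" using \<kappa> by simp
    moreover have "0 \<le> h * (gauss_primitive l - gauss_primitive y)"
      using gauss_primitive_bounds(1)[OF that(2)] h_pos by simp
    ultimately show ?thesis
      by (simp add: barrier_profile_def barrier_primitive_def field_simps)
  qed
  have \<sigma>_quot: "\<sigma> t / sqrt (t + 1) = R t" if "0 \<le> t" for t
    using that by (simp add: \<sigma>_def)
  have \<sigma>_deriv: "(\<sigma> has_real_derivative front_speed A C m t) (at t)" if "0 \<le> t" for t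
    unfolding \<sigma>_def R_def by (rule barrier_front_deriv[OF that])
  let ?d = "\<lambda>x t. barrier h \<kappa> A C m x t - u x t"
  let ?dx = "\<lambda>x t. - barrier_slope h \<kappa> (x / sqrt (t + 1)) / sqrt (t + 1) - ux x t"
  let ?dxx = "\<lambda>x t. (h * (x / sqrt (t + 1)) / 2 * exp (- ((x / sqrt (t + 1))\<^sup>2) / 4) - \<kappa>) / (t + 1) - uxx x t"
  let ?dt = "\<lambda>x t. barrier_t h \<kappa> A C m x t - ut x t"
  have "s t < \<sigma> t \<and> (\<forall>x. 0 \<le> x \<longrightarrow> x \<le> s t \<longrightarrow> 0 < ?d x t)" if "0 \<le> t" for t
  proof (intro conjI allI impI)
    note comparison = free_boundary_comparison[where ?s1.0 = s and ?s2.0 = \<sigma> and d = ?d and dx = ?dx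
        and dxx = ?dxx and dt = ?dt and g' = "\<lambda>t. front_speed A C m t - s' t", OF s_cont]
    have 1: "continuous_on {0..} \<sigma>"
      using \<sigma>_deriv by (auto intro!: DERIV_continuous_on intro: has_field_derivative_at_within)
    have 2: "s 0 < \<sigma> 0" using R(1)[of 0] C A s_init by (simp add: \<sigma>_def R_def barrier_radius_def)
    have 3: "continuous_on {(x, t). 0 \<le> t \<and> 0 \<le> x \<and> x \<le> s t \<and> x \<le> \<sigma> t} (\<lambda>(x, t). ?d x t)"
      unfolding case_prod_unfold
      by (intro continuous_on_diff continuous_on_subset[OF barrier_continuous[unfolded case_prod_unfold]]
          continuous_on_subset[OF u_cont[unfolded case_prod_unfold]]) (auto simp: stefan_closed_def)
    have 4: "0 < ?d x 0" if "0 \<le> x" "x \<le> s 0" for x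
    proof -
      have "u x 0 \<le> M" using initial_value[of x] M that s_init by simp
      also have "M < \<kappa> * (C - b0)" by fact
      also have "\<dots> \<le> \<kappa> * (A + C - x)"
        using that s_init A \<kappa> by (intro mult_left_mono) auto
      also have "\<dots> \<le> barrier h \<kappa> A C m x 0"
        using profile_pos[of x "A + C"] that s_init A C by (simp add: barrier_def barrier_radius_def)
      finally show ?thesis by simp
    qed
    have 5: "((\<lambda>y. ?d y t) has_real_derivative ?dx x t) (at x within {0..s t})"
      if "0 < t" "0 \<le> x" "x \<le> s t" for x t
      using that by (intro DERIV_diff ux_deriv has_field_derivative_at_within[OF barrier_x_deriv]) auto
    have 6: "((\<lambda>y. ?dx y t) has_real_derivative ?dxx x t) (at x)"
      if "0 < t" "0 < x" "x < s t" for x t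
      using that by (intro DERIV_diff interior_derivs barrier_xx_deriv) auto
    have 7: "((\<lambda>r. ?d x r) has_real_derivative ?dt x t) (at t)"
      if "0 < t" "0 < x" "x < s t" for x t
      using that by (intro DERIV_diff interior_derivs barrier_t_deriv) auto
    have 8: "?dxx x t < ?dt x t" if "0 < t" "0 < x" "x < s t" for x t
    proof -
      let ?\<eta> = "x / sqrt (t + 1)"
      have "m * (R t - A) * barrier_slope h \<kappa> (R t) \<le> m * C * S"
        using R[of t] that slope_le[of t] slope_pos[of "R t"] A m C
        by (intro mult_mono mult_nonneg_nonneg) auto
      also have "\<dots> < \<kappa>" by fact
      also have "\<kappa> \<le> \<kappa> * (1 + (?\<eta>\<^sup>2 + ?\<eta>) / 2)"
        using \<kappa> that by (simp add: field_simps)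
      finally have "0 < (\<kappa> * (1 + (?\<eta>\<^sup>2 + ?\<eta>) / 2) - m * (R t - A) * barrier_slope h \<kappa> (R t)) / (t + 1)"
        using that by simp
      then show ?thesis
        using barrier_heat_defect[of t h \<kappa> A C m x] interior_derivs(4)[OF that] that by (simp add: R_def)
    qed
    have 9: "?dx 0 t < 0" if "0 < t" for t
      using that \<kappa> flux_value[OF that] by (simp add: barrier_slope_def flip: add_divide_distrib)
    have 10: "0 < ?d (s t) t \<or> 0 < ?dx (s t) t" if "0 < t" "s t < \<sigma> t" for t
    proof -
      have "s t / sqrt (t + 1) < R t"
        using that by (simp add: \<sigma>_def field_simps)
      then have "0 < \<kappa> * (R t - s t / sqrt (t + 1))" using \<kappa> by simp
      also have "\<dots> \<le> barrier h \<kappa> A C m (s t) t"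
        unfolding barrier_def R_def[symmetric]
        by (rule profile_pos) (use that front_positive[of t] \<open>s t / sqrt (t + 1) < R t\<close> in auto)
      finally show ?thesis using front_zero that by simp
    qed
    have 11: "?d (s t) t = 0" if "0 < t" "s t = \<sigma> t" for t
    proof -
      have "u (\<sigma> t) t = 0" using front_zero that by metis
      then show ?thesis
        using that \<sigma>_quot[of t] by (simp add: barrier_def R_def barrier_profile_def)
    qed
    have 12: "((\<lambda>r. \<sigma> r - s r) has_real_derivative front_speed A C m t - s' t) (at t)" if "0 < t" for t
      using that by (intro DERIV_diff \<sigma>_deriv s_deriv) auto
    have 13: "- ?dx (s t) t < front_speed A C m t - s' t" if "0 < t" "s t = \<sigma> t" for t
    proof -
      have "barrier_slope h \<kappa> (R t) / sqrt (t + 1) < front_speed A C m t"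
        using slope[of t] that by (simp add: front_speed_def R_def divide_strict_right_mono)
      then show ?thesis using stefan_condition that \<sigma>_quot[of t] by simp
    qed
    show "s t < \<sigma> t"
      by (rule comparison(1)) (use 1 2 3 4 5 6 7 8 9 10 11 12 13 front_positive that in auto)
    show "0 < ?d x t" if "0 \<le> x" "x \<le> s t" for x
      by (rule comparison(2)) (use 1 2 3 4 5 6 7 8 9 10 11 12 13 front_positive \<open>0 \<le> t\<close> that in auto)
  qed
  then show ?thesis
    using C m by (intro exI[of _ C] exI[of _ m] conjI) (auto simp: \<sigma>_def R_def)
qed

text \<open>
  Since \<open>u0 0 > 0\<close>, a barrier with initial front \<open>r\<close> close to \<open>0\<close>, whose height is at most \<open>h * r\<close>,
  lies below \<open>u0\<close>. One case is new compared with the upper barrier: at the barrier's front, which is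
  interior for \<open>u\<close>, only \<open>u \<ge> 0\<close> is known. If \<open>u\<close> vanishes there, it has an interior minimum and
  \<open>ux = 0\<close>, while the barrier has a strictly negative slope.
\<close>

lemma above_lower_barrier:
  assumes \<epsilon>: "0 < \<epsilon>" "\<epsilon> < stefan_omega h"
  defines "A \<equiv> stefan_omega h - \<epsilon>" and "\<kappa> \<equiv> - (\<epsilon> / (8 * (stefan_omega h + 1)))"
  shows "\<exists>C<0. \<exists>m>0. \<forall>t\<ge>0. barrier_radius A C m t * sqrt (t + 1) < s t \<and>
    (\<forall>x. 0 \<le> x \<longrightarrow> x \<le> barrier_radius A C m t * sqrt (t + 1) \<longrightarrow> barrier h \<kappa> A C m x t < u x t)"
proof -
  have \<omega>: "0 < stefan_omega h" using stefan_omega(1)[OF h_pos] .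
  have A: "0 < A" using \<epsilon> by (simp add: A_def)
  have \<kappa>: "\<kappa> < 0" using \<omega> \<epsilon> by (simp add: \<kappa>_def)
  obtain \<delta> where \<delta>: "0 < \<delta>" "\<And>x. 0 \<le> x \<Longrightarrow> x < \<delta> \<Longrightarrow> \<bar>u0 x - u0 0\<bar> < u0 0 / 2"
    using u0_cont[unfolded continuous_on_iff, rule_format, of 0 "u0 0 / 2"] u0_origin
    by (auto simp: dist_real_def)
  define r where "r = min (min (b0 / 2) (A / 2)) (min (\<delta> / 2) (u0 0 / (2 * h)))"
  have r: "0 < r" "r < b0" "r < A" "r < \<delta>" "r \<le> u0 0 / (2 * h)"
    using b0_pos A \<delta>(1) u0_origin h_pos by (auto simp: r_def)
  define C where "C = r - A"
  have C: "C < 0" "A + C = r" using r by (auto simp: C_def)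
  define m where "m = min (1 / 4) (\<kappa> / (2 * C * h))"
  have m: "0 < m" "m \<le> 1 / 4" "m * (- C) * h < - \<kappa>"
  proof -
    have "0 < \<kappa> / (2 * C * h)"
      using \<kappa> C h_pos mult_neg_pos[of "2 * C" h] by (intro divide_neg_neg) auto
    then show "0 < m" "m \<le> 1 / 4" by (auto simp: m_def)
    have "m * (- C * h) \<le> \<kappa> / (2 * C * h) * (- C * h)"
      using C h_pos by (intro mult_right_mono) (auto simp: m_def mult_nonpos_nonneg)
    also have "\<dots> = - \<kappa> / 2" using C h_pos by (simp add: field_simps)
    finally show "m * (- C) * h < - \<kappa>" using \<kappa> by simp
  qed
  define R where "R = barrier_radius A C m"
  define \<sigma> where "\<sigma> = (\<lambda>t. R t * sqrt (t + 1))"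
  have R: "R t < A" "A + C \<le> R t" "0 < R t" if t: "0 \<le> t" for t
  proof -
    obtain \<theta> where \<theta>: "0 < \<theta>" "\<theta> \<le> 1" "R t = A + C * \<theta>"
      using barrier_radius_range[OF t, of m A C] m by (auto simp: R_def)
    show "R t < A" using \<theta> C by (simp add: mult_neg_pos)
    have "C * 1 \<le> C * \<theta>" using \<theta> C by (intro mult_left_mono_neg) auto
    then show "A + C \<le> R t" using \<theta> by simp
    then show "0 < R t" using C r by simp
  qed
  have slope: "R t / 2 - m * (R t - A) < barrier_slope h \<kappa> (R t)" if "0 \<le> t" for t
    using lower_slope_bound[OF h_pos \<epsilon>(1), of "R t" m] R[OF that] m by (simp add: A_def \<kappa>_def)
  have slope_pos: "0 < barrier_slope h \<kappa> (R t)" if "0 \<le> t" for t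
  proof -
    have "m * (R t - A) \<le> 0" using m R[OF that] by (simp add: mult_nonneg_nonpos)
    then show ?thesis using slope[OF that] R[OF that] by simp
  qed
  have slope_le: "barrier_slope h \<kappa> (R t) \<le> h" if "0 \<le> t" for t
  proof -
    have "h * exp (- ((R t)\<^sup>2) / 4) \<le> h" using h_pos by (simp add: mult_left_le)
    moreover have "\<kappa> * (R t + 1) \<le> 0" using \<kappa> R[OF that] by (simp add: mult_nonpos_nonneg)
    ultimately show ?thesis by (simp add: barrier_slope_def)
  qed
  have \<sigma>_quot: "\<sigma> t / sqrt (t + 1) = R t" if "0 \<le> t" for t
    using that by (simp add: \<sigma>_def)
  have \<sigma>_pos: "0 < \<sigma> t" if "0 \<le> t" for t
    using that R[OF that] by (simp add: \<sigma>_def)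
  have \<sigma>_deriv: "(\<sigma> has_real_derivative front_speed A C m t) (at t)" if "0 \<le> t" for t
    unfolding \<sigma>_def R_def by (rule barrier_front_deriv[OF that])
  let ?d = "\<lambda>x t. u x t - barrier h \<kappa> A C m x t"
  let ?dx = "\<lambda>x t. ux x t - - barrier_slope h \<kappa> (x / sqrt (t + 1)) / sqrt (t + 1)"
  let ?dxx = "\<lambda>x t. uxx x t - (h * (x / sqrt (t + 1)) / 2 * exp (- ((x / sqrt (t + 1))\<^sup>2) / 4) - \<kappa>) / (t + 1)"
  let ?dt = "\<lambda>x t. ut x t - barrier_t h \<kappa> A C m x t"
  have "\<sigma> t < s t \<and> (\<forall>x. 0 \<le> x \<longrightarrow> x \<le> \<sigma> t \<longrightarrow> 0 < ?d x t)" if "0 \<le> t" for t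
  proof (intro conjI allI impI)
    have 1: "continuous_on {0..} \<sigma>"
      using \<sigma>_deriv by (auto intro!: DERIV_continuous_on intro: has_field_derivative_at_within)
    note comparison = free_boundary_comparison[where ?s1.0 = \<sigma> and ?s2.0 = s and d = ?d and dx = ?dx
        and dxx = ?dxx and dt = ?dt and g' = "\<lambda>t. s' t - front_speed A C m t", OF 1 s_cont]
    have 2: "\<sigma> 0 < s 0" using C r s_init by (simp add: \<sigma>_def R_def barrier_radius_def)
    have 3: "continuous_on {(x, t). 0 \<le> t \<and> 0 \<le> x \<and> x \<le> \<sigma> t \<and> x \<le> s t} (\<lambda>(x, t). ?d x t)"
      unfolding case_prod_unfold
      by (intro continuous_on_diff continuous_on_subset[OF barrier_continuous[unfolded case_prod_unfold]]
          continuous_on_subset[OF u_cont[unfolded case_prod_unfold]]) (auto simp: stefan_closed_def)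
    have 4: "0 < ?d x 0" if "0 \<le> x" "x \<le> \<sigma> 0" for x
    proof -
      have x: "x \<le> r" using that C by (simp add: \<sigma>_def R_def barrier_radius_def)
      have "0 \<le> r\<^sup>2 - x\<^sup>2" using that x by (auto intro: power_mono)
      then have "\<kappa> * ((r\<^sup>2 - x\<^sup>2) / 2 + (r - x)) \<le> 0"
        using \<kappa> x by (intro mult_nonpos_nonneg) auto
      moreover have "h * (gauss_primitive r - gauss_primitive x) \<le> h * r"
        using gauss_primitive_bounds(2)[OF x] that h_pos by (intro mult_left_mono) auto
      moreover have "h * r \<le> u0 0 / 2"
        using mult_left_mono[OF r(5), of h] h_pos by simp
      moreover have "barrier h \<kappa> A C m x 0 =
          h * (gauss_primitive r - gauss_primitive x) + \<kappa> * ((r\<^sup>2 - x\<^sup>2) / 2 + (r - x))"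
        using C(2)
        by (simp add: barrier_def barrier_radius_def barrier_profile_def barrier_primitive_def field_simps)
      moreover have "u0 0 / 2 < u0 x" using \<delta>(2)[of x] x r that by (auto simp: abs_if split: if_splits)
      ultimately show ?thesis using initial_value[of x] that x r by simp
    qed
    have 5: "((\<lambda>y. ?d y t) has_real_derivative ?dx x t) (at x within {0..\<sigma> t})"
      if "0 < t" "\<sigma> t \<le> s t" "0 \<le> x" "x \<le> \<sigma> t" for x t
      using that
      by (intro DERIV_diff DERIV_subset[OF ux_deriv] has_field_derivative_at_within[OF barrier_x_deriv]) auto
    have 6: "((\<lambda>y. ?dx y t) has_real_derivative ?dxx x t) (at x)"
      if "0 < t" "\<sigma> t < s t" "0 < x" "x < \<sigma> t" for x t
      using that by (intro DERIV_diff interior_derivs barrier_xx_deriv) auto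
    have 7: "((\<lambda>r. ?d x r) has_real_derivative ?dt x t) (at t)"
      if "0 < t" "\<sigma> t < s t" "0 < x" "x < \<sigma> t" for x t
      using that by (intro DERIV_diff interior_derivs barrier_t_deriv) auto
    have 8: "?dxx x t < ?dt x t" if "0 < t" "\<sigma> t < s t" "0 < x" "x < \<sigma> t" for x t
    proof -
      let ?\<eta> = "x / sqrt (t + 1)"
      have "m * (A - R t) * barrier_slope h \<kappa> (R t) \<le> m * (- C) * h"
        using R[of t] that slope_le[of t] slope_pos[of t] m C
        by (intro mult_mono mult_nonneg_nonneg) auto
      also have "\<dots> < - \<kappa>" by fact
      also have "- \<kappa> \<le> - \<kappa> * (1 + (?\<eta>\<^sup>2 + ?\<eta>) / 2)"
        using mult_left_mono[of 1 "1 + (?\<eta>\<^sup>2 + ?\<eta>) / 2" "- \<kappa>"] \<kappa> that by simp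
      finally have "m * (A - R t) * barrier_slope h \<kappa> (R t) < - \<kappa> * (1 + (?\<eta>\<^sup>2 + ?\<eta>) / 2)" .
      moreover have "\<kappa> * Y - m * (p - q) * B < 0" if "m * (q - p) * B < - \<kappa> * Y" for p q B Y
        using that by (simp add: algebra_simps)
      ultimately have "\<kappa> * (1 + (?\<eta>\<^sup>2 + ?\<eta>) / 2) - m * (R t - A) * barrier_slope h \<kappa> (R t) < 0"
        by blast
      then have "(\<kappa> * (1 + (?\<eta>\<^sup>2 + ?\<eta>) / 2) - m * (R t - A) * barrier_slope h \<kappa> (R t)) / (t + 1) < 0"
        using that by (simp add: divide_neg_pos)
      then show ?thesis
        using barrier_heat_defect[of t h \<kappa> A C m x] interior_derivs(4)[of t x] that by (simp add: R_def)
    qed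
    have 9: "?dx 0 t < 0" if "0 < t" for t
      using that \<kappa> flux_value[OF that] divide_strict_right_mono[of "- h" "- h - \<kappa>" "sqrt (t + 1)"]
      by (simp add: barrier_slope_def)
    have 10: "0 < ?d (\<sigma> t) t \<or> 0 < ?dx (\<sigma> t) t" if t: "0 < t" "\<sigma> t < s t" for t
    proof (cases "u (\<sigma> t) t = 0")
      case True
      have "ux (\<sigma> t) t = 0"
      proof (rule second_derivative_nonneg_at_min(1)[where f = "\<lambda>y. u y t" and f' = "\<lambda>y. ux y t"
            and x = "\<sigma> t" and a = 0 and b = "s t" and c = "uxx (\<sigma> t) t"])
        show "0 < \<sigma> t" "\<sigma> t < s t" using t \<sigma>_pos by auto
        show "u (\<sigma> t) t \<le> u y t" if "0 < y" "y < s t" for y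
          using nonneg[of t y] that t True by simp
        show "((\<lambda>y. ux y t) has_real_derivative uxx (\<sigma> t) t) (at (\<sigma> t))"
          using t \<sigma>_pos[of t] by (intro interior_derivs) auto
      qed (use t interior_derivs(1) in auto)
      then show ?thesis using slope_pos[of t] \<sigma>_quot[of t] t by simp
    next
      case False
      then have "0 < u (\<sigma> t) t" using nonneg[of t "\<sigma> t"] t \<sigma>_pos[of t] by auto
      then show ?thesis
        using \<sigma>_quot[of t] t by (simp add: barrier_def R_def barrier_profile_def)
    qed
    have 11: "?d (\<sigma> t) t = 0" if "0 < t" "\<sigma> t = s t" for t
      using that front_zero \<sigma>_quot[of t] by (simp add: barrier_def R_def barrier_profile_def)
    have 12: "((\<lambda>r. s r - \<sigma> r) has_real_derivative s' t - front_speed A C m t) (at t)" if "0 < t" for t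
      using that by (intro DERIV_diff \<sigma>_deriv s_deriv) auto
    have 13: "- ?dx (\<sigma> t) t < s' t - front_speed A C m t" if "0 < t" "\<sigma> t = s t" for t
    proof -
      have "front_speed A C m t < barrier_slope h \<kappa> (R t) / sqrt (t + 1)"
        using slope[of t] that by (simp add: front_speed_def R_def divide_strict_right_mono)
      then show ?thesis using stefan_condition that \<sigma>_quot[of t] by simp
    qed
    show "\<sigma> t < s t"
      by (rule comparison(1)) (use 2 3 4 5 6 7 8 9 10 11 12 13 \<sigma>_pos that in auto)
    show "0 < ?d x t" if "0 \<le> x" "x \<le> \<sigma> t" for x
      by (rule comparison(2)) (use 2 3 4 5 6 7 8 9 10 11 12 13 \<sigma>_pos \<open>0 \<le> t\<close> that in auto)
  qed
  then show ?thesis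
    using C m by (intro exI[of _ C] exI[of _ m] conjI) (auto simp: \<sigma>_def R_def)
qed

lemma eventually_upper_bound:
  assumes \<epsilon>: "0 < \<epsilon>" "\<epsilon> \<le> 1"
  shows "\<forall>\<^sub>F t in at_top. s t / sqrt (t + 1) < stefan_omega h + 2 * \<epsilon> \<and>
    (\<forall>x. 0 \<le> x / sqrt (t + 1) \<longrightarrow> x / sqrt (t + 1) \<le> stefan_omega h \<longrightarrow>
      zero_extension s u x t \<le> stefan_profile h (x / sqrt (t + 1)) + \<epsilon> * (2 * h + stefan_omega h + 2))"
proof -
  define A where "A = stefan_omega h + \<epsilon>"
  define \<kappa> where "\<kappa> = \<epsilon> / (8 * (stefan_omega h + 1))"
  have \<omega>: "0 < stefan_omega h" using stefan_omega(1)[OF h_pos] .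
  obtain C m where Cm: "0 < C" "0 < m"
      and bound: "\<And>t. 0 \<le> t \<Longrightarrow> s t < barrier_radius A C m t * sqrt (t + 1)"
        "\<And>t x. 0 \<le> t \<Longrightarrow> 0 \<le> x \<Longrightarrow> x \<le> s t \<Longrightarrow> u x t < barrier h \<kappa> A C m x t"
    using below_upper_barrier[OF \<epsilon>] unfolding A_def[symmetric] \<kappa>_def[symmetric] by blast
  have "\<forall>\<^sub>F t in at_top. barrier_radius A C m t < stefan_omega h + 2 * \<epsilon>"
    using barrier_radius_tendsto[OF Cm(2)] \<epsilon> by (intro order_tendstoD(2)) (auto simp: A_def)
  with eventually_ge_at_top[of 0] show ?thesis
  proof eventually_elim
    case (elim t)
    let ?l = "barrier_radius A C m t"
    obtain \<theta> where "0 < \<theta>" "?l = A + C * \<theta>"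
      using barrier_radius_range[of t m A C] Cm elim by auto
    then have l: "stefan_omega h < ?l" using Cm \<epsilon> by (auto simp: A_def add_pos_pos)
    have root: "0 < sqrt (t + 1)" using elim by simp
    have "s t / sqrt (t + 1) < ?l" using bound(1)[of t] elim root by (simp add: pos_divide_less_eq)
    then have "s t / sqrt (t + 1) < stefan_omega h + 2 * \<epsilon>" using elim by simp
    moreover have "zero_extension s u x t \<le> stefan_profile h (x / sqrt (t + 1)) + \<epsilon> * (2 * h + stefan_omega h + 2)"
      if x: "0 \<le> x / sqrt (t + 1)" "x / sqrt (t + 1) \<le> stefan_omega h" for x
    proof (cases "x \<le> s t")
      case True
      have "0 \<le> x" using x root by (simp add: zero_le_divide_iff)
      have "\<bar>barrier_profile h \<kappa> ?l (x / sqrt (t + 1)) - stefan_profile h (x / sqrt (t + 1))\<bar>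
          \<le> \<epsilon> * (2 * h + stefan_omega h + 2)"
        using barrier_profile_gap[OF h_pos \<epsilon> x(1) _ x(2), of ?l \<kappa>] x l elim \<epsilon> \<omega> by (simp add: \<kappa>_def)
      then show ?thesis
        using bound(2)[of t x] True \<open>0 \<le> x\<close> elim by (simp add: zero_extension_def barrier_def)
    next
      case False
      have "0 \<le> stefan_profile h (x / sqrt (t + 1))"
        using stefan_profile_eq[OF x(2)] gauss_primitive_bounds(1)[OF x(2)] h_pos by simp
      then show ?thesis using False \<epsilon> h_pos \<omega> by (simp add: zero_extension_def)
    qed
    ultimately show ?case by blast
  qed
qed

text \<open>
  Between the front of the lower barrier and \<open>\<omega>\<close> the barrier gives no information; there the target
  profile itself is at most \<open>2 * h * \<epsilon>\<close> and \<open>u \<ge> 0\<close> suffices.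
\<close>

lemma eventually_lower_bound:
  assumes \<epsilon>: "0 < \<epsilon>" "\<epsilon> \<le> 1" "\<epsilon> < stefan_omega h"
  shows "\<forall>\<^sub>F t in at_top. stefan_omega h - 2 * \<epsilon> < s t / sqrt (t + 1) \<and>
    (\<forall>x. 0 \<le> x / sqrt (t + 1) \<longrightarrow> x / sqrt (t + 1) \<le> stefan_omega h \<longrightarrow>
      stefan_profile h (x / sqrt (t + 1)) - \<epsilon> * (2 * h + stefan_omega h + 2) \<le> zero_extension s u x t)"
proof -
  define A where "A = stefan_omega h - \<epsilon>"
  define \<kappa> where "\<kappa> = - (\<epsilon> / (8 * (stefan_omega h + 1)))"
  have \<omega>: "0 < stefan_omega h" using stefan_omega(1)[OF h_pos] .
  obtain C m where Cm: "C < 0" "0 < m"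
      and bound: "\<And>t. 0 \<le> t \<Longrightarrow> barrier_radius A C m t * sqrt (t + 1) < s t"
        "\<And>t x. 0 \<le> t \<Longrightarrow> 0 \<le> x \<Longrightarrow> x \<le> barrier_radius A C m t * sqrt (t + 1) \<Longrightarrow>
          barrier h \<kappa> A C m x t < u x t"
    using above_lower_barrier[OF \<epsilon>(1,3)] unfolding A_def[symmetric] \<kappa>_def[symmetric] by blast
  have "\<forall>\<^sub>F t in at_top. stefan_omega h - 2 * \<epsilon> < barrier_radius A C m t"
    using barrier_radius_tendsto[OF Cm(2)] \<epsilon> by (intro order_tendstoD(1)) (auto simp: A_def)
  with eventually_ge_at_top[of 0] show ?thesis
  proof eventually_elim
    case (elim t)
    let ?l = "barrier_radius A C m t"
    obtain \<theta> where "0 < \<theta>" "?l = A + C * \<theta>"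
      using barrier_radius_range[of t m A C] Cm elim by auto
    moreover have "C * \<theta> < 0" using Cm \<open>0 < \<theta>\<close> by (simp add: mult_neg_pos)
    ultimately have l: "?l < stefan_omega h" using \<epsilon> by (simp add: A_def)
    have root: "0 < sqrt (t + 1)" using elim by simp
    have "?l < s t / sqrt (t + 1)" using bound(1)[of t] elim root by (simp add: pos_less_divide_eq)
    then have "stefan_omega h - 2 * \<epsilon> < s t / sqrt (t + 1)" using elim by simp
    moreover have "stefan_profile h (x / sqrt (t + 1)) - \<epsilon> * (2 * h + stefan_omega h + 2) \<le> zero_extension s u x t"
      if x: "0 \<le> x / sqrt (t + 1)" "x / sqrt (t + 1) \<le> stefan_omega h" for x
    proof (cases "x / sqrt (t + 1) \<le> ?l")
      case True
      have "0 \<le> x" using x root by (simp add: zero_le_divide_iff)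
      have "x \<le> ?l * sqrt (t + 1)" using True root by (simp add: pos_divide_le_eq)
      have "\<bar>barrier_profile h \<kappa> ?l (x / sqrt (t + 1)) - stefan_profile h (x / sqrt (t + 1))\<bar>
          \<le> \<epsilon> * (2 * h + stefan_omega h + 2)"
        using barrier_profile_gap[OF h_pos \<epsilon>(1,2) x(1) True x(2), of \<kappa>] l elim \<epsilon> \<omega> by (simp add: \<kappa>_def)
      then show ?thesis
        using bound(1)[of t] bound(2)[of t x] \<open>x \<le> ?l * sqrt (t + 1)\<close> \<open>0 \<le> x\<close> elim
        by (simp add: zero_extension_def barrier_def)
    next
      case False
      have "gauss_primitive (stefan_omega h) - gauss_primitive (x / sqrt (t + 1)) \<le> 2 * \<epsilon>"
        using gauss_primitive_bounds(2)[OF x(2)] False elim by simp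
      then have "stefan_profile h (x / sqrt (t + 1)) \<le> h * (2 * \<epsilon>)"
        using stefan_profile_eq[OF x(2)] h_pos by simp
      also have "\<dots> \<le> \<epsilon> * (2 * h + stefan_omega h + 2)"
        using \<epsilon> \<omega> by (simp add: algebra_simps)
      finally have "stefan_profile h (x / sqrt (t + 1)) \<le> \<epsilon> * (2 * h + stefan_omega h + 2)" .
      moreover have "0 \<le> zero_extension s u x t"
        using nonneg[of t x] elim x root by (auto simp: zero_extension_def zero_le_divide_iff)
      ultimately show ?thesis by simp
    qed
    ultimately show ?case by blast
  qed
qed

lemma front_asymptotics: "((\<lambda>t. s t / sqrt (t + 1)) \<longlongrightarrow> stefan_omega h) at_top"
proof (rule tendstoI)
  fix e :: real assume "0 < e"
  define \<epsilon> where "\<epsilon> = min (e / 2) (min 1 (stefan_omega h / 2))"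
  have \<epsilon>: "0 < \<epsilon>" "\<epsilon> \<le> 1" "\<epsilon> < stefan_omega h" "2 * \<epsilon> \<le> e"
    using \<open>0 < e\<close> stefan_omega(1)[OF h_pos] by (auto simp: \<epsilon>_def)
  show "\<forall>\<^sub>F t in at_top. dist (s t / sqrt (t + 1)) (stefan_omega h) < e"
    using eventually_upper_bound[OF \<epsilon>(1,2)] eventually_lower_bound[OF \<epsilon>(1-3)]
    by eventually_elim (use \<epsilon>(4) in \<open>auto simp: dist_real_def abs_less_iff\<close>)
qed

lemma profile_asymptotics:
  "((\<lambda>t. SUP x\<in>{x. x / sqrt (t + 1) \<in> {0..stefan_omega h}}.
      \<bar>zero_extension s u x t - stefan_profile h (x / sqrt (t + 1))\<bar>) \<longlongrightarrow> 0) at_top"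
proof (rule tendstoI)
  fix e :: real assume "0 < e"
  define K where "K = 2 * h + stefan_omega h + 2"
  have K: "0 < K" using h_pos stefan_omega(1)[OF h_pos] by (simp add: K_def)
  define \<epsilon> where "\<epsilon> = min (e / (2 * K)) (min 1 (stefan_omega h / 2))"
  have \<epsilon>: "0 < \<epsilon>" "\<epsilon> \<le> 1" "\<epsilon> < stefan_omega h"
    using \<open>0 < e\<close> stefan_omega(1)[OF h_pos] K by (auto simp: \<epsilon>_def)
  have "\<epsilon> * K \<le> e / (2 * K) * K" using K by (intro mult_right_mono) (auto simp: \<epsilon>_def)
  also have "\<dots> < e" using K \<open>0 < e\<close> by simp
  finally have \<epsilon>K: "\<epsilon> * K < e" .
  show "\<forall>\<^sub>F t in at_top. dist (SUP x\<in>{x. x / sqrt (t + 1) \<in> {0..stefan_omega h}}.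
      \<bar>zero_extension s u x t - stefan_profile h (x / sqrt (t + 1))\<bar>) 0 < e"
    using eventually_upper_bound[OF \<epsilon>(1,2)] eventually_lower_bound[OF \<epsilon>]
  proof eventually_elim
    case (elim t)
    let ?X = "{x. x / sqrt (t + 1) \<in> {0..stefan_omega h}}"
    let ?f = "\<lambda>x. \<bar>zero_extension s u x t - stefan_profile h (x / sqrt (t + 1))\<bar>"
    have bound: "?f x \<le> \<epsilon> * K" if "x \<in> ?X" for x
    proof -
      have "zero_extension s u x t \<le> stefan_profile h (x / sqrt (t + 1)) + \<epsilon> * K"
        "stefan_profile h (x / sqrt (t + 1)) - \<epsilon> * K \<le> zero_extension s u x t"
        using elim that unfolding K_def by auto
      then show ?thesis by (simp add: abs_le_iff)
    qed
    have zero: "0 \<in> ?X" using stefan_omega(1)[OF h_pos] by simp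
    have "(SUP x\<in>?X. ?f x) \<le> \<epsilon> * K"
      using zero bound by (intro cSUP_least) blast+
    moreover have "0 \<le> (SUP x\<in>?X. ?f x)"
      using zero bound by (intro cSUP_upper2[where x = 0] bdd_aboveI2[where M = "\<epsilon> * K"]) auto
    ultimately show ?case using \<epsilon>K by (simp add: dist_real_def)
  qed
qed

end

theorem theorem1:
  fixes h b0 :: real and u0 s :: "real \<Rightarrow> real" and u :: "real \<Rightarrow> real \<Rightarrow> real"
  assumes "0 < h" and "0 < b0"
    and "W1inf_on {0<..} u0" and "continuous_on {0..} u0"
    and "\<And>x. 0 \<le> x \<Longrightarrow> 0 \<le> u0 x"
    and "0 < u0 0"
    and "\<And>x. b0 \<le> x \<Longrightarrow> u0 x = 0"
    and "classical_stefan_solution h b0 u0 u s"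
  shows "((\<lambda>t. s t / sqrt (t + 1)) \<longlongrightarrow> stefan_omega h) at_top \<and>
    ((\<lambda>t. SUP x\<in>{x. x / sqrt (t + 1) \<in> {0..stefan_omega h}}.
        \<bar>zero_extension s u x t - stefan_profile h (x / sqrt (t + 1))\<bar>) \<longlongrightarrow> 0) at_top"
proof -
  obtain s' ux uxx ut where "stefan_flow h b0 u0 s s' u ux uxx ut"
    using assms unfolding classical_stefan_solution_def stefan_flow_def by blast
  then interpret stefan_flow h b0 u0 s s' u ux uxx ut .
  show ?thesis using front_asymptotics profile_asymptotics by blast
qed

end
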